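(* If a nontrivial dynamical system $(X,T)$ (i.e. $|X|>1$) is transitive and has the shadowing property, then the set of strongly mixing measures is of first category in $M_T(X)$.
   Context: A dynamical system $(X,T)$ is a compact metric space $(X,d)$ with a continuous map $T\colon X\to X$ (not necessarily invertible). It is transitive if for any two nonempty open sets $U,V\subset X$ there is $n>0$ with $T^n(U)\cap V\neq\emptyset$. A sequence $(x_n)_{n=0}^\infty$ in $X$ is a $\delta$-pseudo-orbit if $d(T(x_n),x_{n+1})<\delta$ for all $n\ge 0$; it is $\varepsilon$-traced by $y\in X$ if $d(T^n(y),x_n)<\varepsilon$ for all $n\ge 0$. $(X,T)$ has the shadowing property if for every $\varepsilon>0$ there is $\delta>0$ such that every $\delta$-pseudo-orbit is $\varepsilon$-traced by some point of $X$. $M_T(X)$ is the space of $T$-invariant Borel probability measures on $X$ with the weak$^*$-topology. A measure $\mu\in M_T(X)$ is strongly mixing if $\lim_{k\to\infty}\mu(A\cap T^{-k}(B))=\mu(A)\mu(B)$ for all Borel sets $A,B$. *)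

theory Defs
  imports "HOL-Probability.Probability"
begin

text \<open>The phase space is an entire type of class \<open>metric_space\<close> whose universe is compact;
  no invertibility of the map is required.\<close>

definition dynamical_system :: "('a::metric_space \<Rightarrow> 'a) \<Rightarrow> bool" where
  "dynamical_system T \<longleftrightarrow> compact (UNIV :: 'a set) \<and> continuous_on UNIV T"

definition transitive_system :: "('a::topological_space \<Rightarrow> 'a) \<Rightarrow> bool" where
  "transitive_system T \<longleftrightarrow>
    (\<forall>U V. open U \<and> U \<noteq> {} \<and> open V \<and> V \<noteq> {} \<longrightarrow> (\<exists>n>0. (T ^^ n) ` U \<inter> V \<noteq> {}))"

definition pseudo_orbit :: "('a::metric_space \<Rightarrow> 'a) \<Rightarrow> real \<Rightarrow> (nat \<Rightarrow> 'a) \<Rightarrow> bool" where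
  "pseudo_orbit T \<delta> x \<longleftrightarrow> (\<forall>n. dist (T (x n)) (x (Suc n)) < \<delta>)"

definition traced_by :: "('a::metric_space \<Rightarrow> 'a) \<Rightarrow> real \<Rightarrow> (nat \<Rightarrow> 'a) \<Rightarrow> 'a \<Rightarrow> bool" where
  "traced_by T \<epsilon> x y \<longleftrightarrow> (\<forall>n. dist ((T ^^ n) y) (x n) < \<epsilon>)"

definition shadowing_property :: "('a::metric_space \<Rightarrow> 'a) \<Rightarrow> bool" where
  "shadowing_property T \<longleftrightarrow>
    (\<forall>\<epsilon>>0. \<exists>\<delta>>0. \<forall>x. pseudo_orbit T \<delta> x \<longrightarrow> (\<exists>y. traced_by T \<epsilon> x y))"

definition invariant_measures :: "('a::topological_space \<Rightarrow> 'a) \<Rightarrow> 'a measure set" where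
  "invariant_measures T = {\<mu>. prob_space \<mu> \<and> sets \<mu> = sets borel \<and>
     (\<forall>A \<in> sets borel. measure \<mu> (T -` A) = measure \<mu> A)}"

text \<open>The coarsest topology on the invariant measures making \<open>\<mu> \<mapsto> \<integral> f d\<mu>\<close> continuous for
  every continuous real-valued \<open>f\<close>. On a compact space such \<open>f\<close> is bounded, hence integrable,
  so no default value of the integral is involved.\<close>

definition weak_star_topology :: "('a::topological_space \<Rightarrow> 'a) \<Rightarrow> 'a measure topology" where
  "weak_star_topology T = topology_generated_by
     {{\<mu> \<in> invariant_measures T. (\<integral>x. f x \<partial>\<mu>) \<in> W} |
        (f :: 'a \<Rightarrow> real) W. continuous_on UNIV f \<and> open W}"

lemma topspace_weak_star_topology: "topspace (weak_star_topology T) = invariant_measures T"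
proof -
  have "invariant_measures T \<in> {{\<mu> \<in> invariant_measures T. (\<integral>x. f x \<partial>\<mu>) \<in> W} |
        (f :: 'a \<Rightarrow> real) W. continuous_on UNIV f \<and> open W}"
    by (rule CollectI, rule exI[of _ "\<lambda>_. 0"], rule exI[of _ UNIV]) simp
  then show ?thesis
    unfolding weak_star_topology_def topology_generated_by_topspace by blast
qed

definition strongly_mixing_measures :: "('a::topological_space \<Rightarrow> 'a) \<Rightarrow> 'a measure set" where
  "strongly_mixing_measures T = {\<mu> \<in> invariant_measures T.
     \<forall>A \<in> sets borel. \<forall>B \<in> sets borel.
       (\<lambda>k. measure \<mu> (A \<inter> (T ^^ k) -` B)) \<longlonglongrightarrow> measure \<mu> A * measure \<mu> B}"

definition nowhere_dense_in :: "'b topology \<Rightarrow> 'b set \<Rightarrow> bool" where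
  "nowhere_dense_in X N \<longleftrightarrow> N \<subseteq> topspace X \<and> X interior_of (X closure_of N) = {}"

definition first_category_in :: "'b topology \<Rightarrow> 'b set \<Rightarrow> bool" where
  "first_category_in X S \<longleftrightarrow> (\<exists>N :: nat \<Rightarrow> 'b set. (\<forall>n. nowhere_dense_in X (N n)) \<and> S = (\<Union>n. N n))"

end

theory Submission
  imports Defs
begin

text \<open>Fix a continuous \<open>f\<close> taking different values at two points. For a strongly mixing \<open>\<mu>\<close> the
  correlations \<open>\<integral>f \<cdot> (f \<circ> T\<^sup>k) d\<mu>\<close> tend to \<open>(\<integral>f d\<mu>)\<^sup>2\<close>, whereas a measure on which \<open>T\<^sup>N\<close> is close
  to the identity has \<open>\<integral>f \<cdot> (f \<circ> T\<^sup>N) d\<nu>\<close> close to \<open>\<integral>f\<^sup>2 d\<nu>\<close>. Measures of the second kind, for arbitrarily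
  large \<open>N\<close> and with \<open>f\<close> of positive variance, are dense: given \<open>\<mu>\<close>, finitely many long orbit segments
  reproduce the \<open>\<mu>\<close>-integrals of finitely many test functions, because by invariance
  \<open>\<integral>g d\<mu>\<close> is the \<open>\<mu>\<close>-average of the length \<open>L\<close> orbit averages of \<open>g\<close>. Transitivity closes these segments up to a
  periodic pseudo-orbit with connecting pieces of bounded length, shadowing yields a point following
  it, and every limit \<open>\<nu>\<close> of the empirical measures of that point is as required.
  So the strongly mixing measures are covered by countably many closed sets that are
  defined by lower bounds on the variance and upper bounds on the correlations and that have empty
  interior, together with the closed set where the variance vanishes.\<close>

subsection \<open>Weak sequential compactness of Borel probability measures\<close>

text \<open>For each \<open>k\<close> finitely many balls of radius \<open>1 / Suc k\<close> cover
  the space, and \<open>A\<close> enumerates the balls of all these covers. Two points with the same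
  membership pattern in the balls of one cover lie in a common ball. Points thus become 0-1
  sequences whose first digits determine the location up to \<open>e\<close>.\<close>

lemma separating_open_sequence:
  assumes "compact (UNIV :: 'a::metric_space set)"
  obtains A :: "nat \<Rightarrow> 'a::metric_space set" where "\<And>i. open (A i)"
    and "\<And>e. e > 0 \<Longrightarrow> \<exists>n. \<forall>x y. (\<forall>i<n. x \<in> A i \<longleftrightarrow> y \<in> A i) \<longrightarrow> dist x y < e"
proof -
  have "\<exists>C. finite C \<and> (UNIV :: 'a set) \<subseteq> (\<Union>c\<in>C. ball c (1 / Suc k))" for k
  proof (rule compactE_image[OF assms, of UNIV "\<lambda>c. ball c (1 / Suc k)"])
    show "UNIV \<subseteq> (\<Union>c. ball c (1 / Suc k))" by (auto intro!: exI[where P = "\<lambda>c. dist c _ < _"])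
  qed auto
  then obtain C :: "nat \<Rightarrow> 'a set"
    where C: "\<And>k. finite (C k)" "\<And>k. UNIV \<subseteq> (\<Union>c\<in>C k. ball c (1 / Suc k))"
    by metis
  define S where "S = (\<Union>k. (\<lambda>c. ball c (1 / Suc k)) ` C k)"
  define A where "A = from_nat_into S"
  have "countable S"
    unfolding S_def using C(1) by (auto intro: countable_finite)
  moreover have "S \<noteq> {}"
    unfolding S_def using C(2)[of 0] by fastforce
  ultimately have rA: "range A = S"
    unfolding A_def by (simp add: range_from_nat_into)
  show ?thesis
  proof
    show "open (A i)" for i
    proof -
      have "A i \<in> S" using rA by blast
      then show ?thesis unfolding S_def by auto
    qed
    fix e :: real assume "e > 0"
    then obtain k where k: "1 / Suc k < e / 2"
      using nat_approx_posE[of "e / 2"] by auto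
    let ?B = "(\<lambda>c. ball c (1 / Suc k)) ` C k"
    have "?B \<subseteq> range A" unfolding rA S_def by blast
    then obtain I where I: "finite I" "?B = A ` I"
      using C(1) finite_subset_image[of ?B A UNIV] by blast
    then obtain n where n: "\<And>i. i \<in> I \<Longrightarrow> i < n"
      using I(1) unfolding finite_nat_set_iff_bounded by metis
    have "dist x y < e" if "\<forall>i<n. x \<in> A i \<longleftrightarrow> y \<in> A i" for x y
    proof -
      obtain c where c: "c \<in> C k" "x \<in> ball c (1 / Suc k)" using C(2)[of k] by blast
      then obtain i where i: "i \<in> I" "A i = ball c (1 / Suc k)" using I(2) by (metis imageE imageI)
      then have "y \<in> ball c (1 / Suc k)" using that n c(2) by blast
      with c(2) have "dist c x < e / 2" "dist c y < e / 2" using k by auto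
      then show ?thesis using dist_triangle_half_r by blast
    qed
    then show "\<exists>n. \<forall>x y. (\<forall>i<n. x \<in> A i \<longleftrightarrow> y \<in> A i) \<longrightarrow> dist x y < e" by blast
  qed
qed

lemma summable_base4: "summable (\<lambda>j. of_bool (b j) / 4 ^ j :: real)"
  by (rule summable_comparison_test'[of "\<lambda>j. (1 / 4) ^ j"]) (use summable_geometric[of "1 / 4 :: real"] in \<open>auto simp: power_one_over\<close>)

text \<open>At the first index \<open>m\<close> of disagreement the terms differ by
  \<open>1 / 4 ^ m\<close>, and all later terms together undo at most a third of that. In base 2 the
  tail could undo it entirely, and two sequences could share one sum.\<close>

lemma base4_code_gap:
  fixes b c :: "nat \<Rightarrow> bool"
  assumes "b i \<noteq> c i" "i < n"
  shows "2 / 3 / 4 ^ n \<le> \<bar>(\<Sum>j. of_bool (b j) / 4 ^ j) - (\<Sum>j. of_bool (c j) / 4 ^ j :: real)\<bar>"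
proof -
  define m where "m = (LEAST j. b j \<noteq> c j)"
  have m: "b m \<noteq> c m" unfolding m_def using assms(1) by (rule LeastI)
  have less: "b j = c j" if "j < m" for j using not_less_Least that unfolding m_def by blast
  have "m \<le> i" unfolding m_def using assms(1) by (rule Least_le)
  then have "m \<le> n" using assms(2) by simp
  define d :: "nat \<Rightarrow> real" where "d j = of_bool (b j) / 4 ^ j - of_bool (c j) / 4 ^ j" for j
  have sd: "summable d" unfolding d_def by (intro summable_diff summable_base4)
  have "(\<Sum>j. of_bool (b j) / 4 ^ j) - (\<Sum>j. of_bool (c j) / 4 ^ j) = suminf d"
    unfolding d_def by (intro suminf_diff summable_base4)
  also have "suminf d = (\<Sum>j. d (j + Suc m)) + (\<Sum>j<Suc m. d j)"
    by (rule suminf_split_initial_segment[OF sd])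
  also have "(\<Sum>j<Suc m. d j) = d m"
    using less by (simp add: d_def)
  finally have eq: "(\<Sum>j. of_bool (b j) / 4 ^ j) - (\<Sum>j. of_bool (c j) / 4 ^ j) = (\<Sum>j. d (j + Suc m)) + d m" .
  have dm: "\<bar>d m\<bar> = 1 / 4 ^ m" using m by (cases "b m") (auto simp: d_def)
  have "\<bar>\<Sum>j. d (j + Suc m)\<bar> \<le> (\<Sum>j. (1 / 4) ^ j * (1 / 4 ^ Suc m) :: real)"
    unfolding real_norm_def[symmetric]
  proof (rule norm_suminf_le)
    show "norm (d (j + Suc m)) \<le> (1 / 4) ^ j * (1 / 4 ^ Suc m)" for j
      by (auto simp: d_def power_add power_divide)
    show "summable (\<lambda>j. (1 / 4) ^ j * (1 / 4 ^ Suc m) :: real)"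
      by (intro summable_mult2 summable_geometric) simp
  qed
  also have "\<dots> = (\<Sum>j. (1 / 4) ^ j :: real) * (1 / 4 ^ Suc m)"
    by (rule suminf_mult2[symmetric]) (simp add: summable_geometric)
  also have "\<dots> = 1 / 3 * (1 / 4 ^ m)" by (subst suminf_geometric) auto
  finally have "2 / 3 * (1 / 4 ^ m) \<le> \<bar>(\<Sum>j. d (j + Suc m)) + d m\<bar>" using dm by linarith
  moreover have "1 / 4 ^ n \<le> (1 / 4 ^ m :: real)"
    using \<open>m \<le> n\<close> by (simp add: divide_simps)
  ultimately show ?thesis unfolding eq by linarith
qed

lemma continuous_bounded_compact:
  fixes f :: "'a::topological_space \<Rightarrow> real"
  assumes "compact (UNIV :: 'a set)" "continuous_on UNIV f"
  obtains B where "B > 0" "\<And>x. \<bar>f x\<bar> \<le> B"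
proof -
  have "bounded (range f)"
    using assms by (intro compact_imp_bounded compact_continuous_image)
  then show ?thesis using that unfolding bounded_pos by auto
qed

lemma integrable_continuous_compact:
  fixes f :: "'a::topological_space \<Rightarrow> real"
  assumes "compact (UNIV :: 'a set)" "continuous_on UNIV f" "finite_measure M" "sets M = sets borel"
  shows "integrable M f"
proof -
  interpret finite_measure M by fact
  obtain B where "B > 0" "\<And>x. \<bar>f x\<bar> \<le> B"
    using continuous_bounded_compact[OF assms(1,2)] by blast
  moreover have "f \<in> borel_measurable M"
    using borel_measurable_continuous_onI[OF assms(2)] assms(4) by (simp cong: measurable_cong_sets)
  ultimately show ?thesis by (intro integrable_const_bound[of _ B]) auto
qed

theorem weak_convergent_subsequence_compact:
  fixes \<mu> :: "nat \<Rightarrow> 'a::metric_space measure"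
  assumes cpt: "compact (UNIV :: 'a set)"
    and prob: "\<And>k. prob_space (\<mu> k)" and sets: "\<And>k. sets (\<mu> k) = sets borel"
  obtains r \<nu> where "strict_mono (r :: nat \<Rightarrow> nat)" "prob_space \<nu>" "sets \<nu> = sets borel"
    "\<And>f :: 'a \<Rightarrow> real. continuous_on UNIV f \<Longrightarrow> (\<lambda>k. \<integral>x. f x \<partial>\<mu> (r k)) \<longlonglongrightarrow> (\<integral>x. f x \<partial>\<nu>)"
proof -
  obtain A :: "nat \<Rightarrow> 'a set" where A: "\<And>i. open (A i)"
    "\<And>e. e > 0 \<Longrightarrow> \<exists>n. \<forall>x y. (\<forall>i<n. x \<in> A i \<longleftrightarrow> y \<in> A i) \<longrightarrow> dist x y < e"
    using separating_open_sequence[OF cpt] by blast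
  txt \<open>Coding points by reals reduces the claim to Helly's selection theorem. The code \<open>h\<close> is only
    Borel, but its inverse is uniformly continuous, so the closure of its graph is the graph of a
    continuous decoding map \<open>G\<close> on a compact set \<open>C\<close> of reals.\<close>
  define h :: "'a \<Rightarrow> real" where "h x = (\<Sum>j. of_bool (x \<in> A j) / 4 ^ j)" for x
  have h_meas: "h \<in> borel_measurable borel"
  proof -
    have "(\<lambda>x. of_bool (x \<in> A j) / 4 ^ j :: real) \<in> borel_measurable borel" for j
    proof -
      have "(\<lambda>x. of_bool (x \<in> A j) / 4 ^ j :: real) = (\<lambda>x. indicator (A j) x / 4 ^ j)"
        by (auto simp: indicator_def)
      then show ?thesis using A(1)[of j] by simp
    qed
    then show ?thesis unfolding h_def by (rule borel_measurable_suminf)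
  qed
  have h0: "0 \<le> h x" for x unfolding h_def by (intro suminf_nonneg summable_base4) auto
  have h2: "h x \<le> 4 / 3" for x
  proof -
    have "h x \<le> (\<Sum>j. (1 / 4 :: real) ^ j)"
      unfolding h_def by (intro suminf_le summable_base4 summable_geometric) (auto simp: power_divide)
    then show ?thesis by (subst (asm) suminf_geometric) auto
  qed
  define \<Gamma> where "\<Gamma> = closure (range (\<lambda>x. (h x, x)))"
  have "compact \<Gamma>"
  proof -
    have "compact ({0..4/3::real} \<times> (UNIV :: 'a set))" using cpt by (intro compact_Times) auto
    moreover have "range (\<lambda>x. (h x, x)) \<subseteq> {0..4/3::real} \<times> UNIV" using h0 h2 by auto
    ultimately have "\<Gamma> \<subseteq> {0..4/3::real} \<times> UNIV"
      unfolding \<Gamma>_def by (intro closure_minimal compact_imp_closed)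
    then show ?thesis
      using compact_Int_closed[OF \<open>compact ({0..4/3::real} \<times> UNIV)\<close>, of \<Gamma>]
      by (simp add: inf.absorb2 \<Gamma>_def)
  qed
  \<comment> \<open>Points of the graph of \<open>h\<close> near \<open>(t, x)\<close> and
    \<open>(t, y)\<close> have nearly equal codes, so by \<open>base4_code_gap\<close> they agree on
    the first \<open>n\<close> sets and are close to each other. Two code errors below
    \<open>1 / 3 / 4 ^ n\<close> just fit the gap \<open>2 / 3 / 4 ^ n\<close>.\<close>
  have inj: "x = y" if tx: "(t, x) \<in> \<Gamma>" and ty: "(t, y) \<in> \<Gamma>" for t x y
  proof (rule ccontr)
    assume "x \<noteq> y"
    define e where "e = dist x y / 3"
    have "e > 0" using \<open>x \<noteq> y\<close> by (simp add: e_def)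
    then obtain n where n: "\<And>x y. (\<forall>i<n. x \<in> A i \<longleftrightarrow> y \<in> A i) \<Longrightarrow> dist x y < e"
      using A(2) by blast
    define g :: real where "g = min e (1 / 3 / 4 ^ n)"
    have "g > 0" using \<open>e > 0\<close> by (simp add: g_def)
    obtain a where a: "dist (h a, a) (t, x) < g"
      using tx \<open>g > 0\<close> unfolding \<Gamma>_def closure_approachable by blast
    obtain b where b: "dist (h b, b) (t, y) < g"
      using ty \<open>g > 0\<close> unfolding \<Gamma>_def closure_approachable by blast
    have "dist (h a) t < g" "dist a x < g" "dist (h b) t < g" "dist b y < g"
      using a b dist_fst_le[of "(h a, a)" "(t, x)"] dist_snd_le[of "(h a, a)" "(t, x)"]
        dist_fst_le[of "(h b, b)" "(t, y)"] dist_snd_le[of "(h b, b)" "(t, y)"] by auto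
    then have ab: "\<bar>h a - h b\<bar> < 2 / 3 / 4 ^ n" "dist a x < e" "dist b y < e"
      unfolding g_def dist_real_def by linarith+
    have "dist a b < e"
    proof (rule n, rule ccontr)
      assume "\<not> (\<forall>i<n. a \<in> A i \<longleftrightarrow> b \<in> A i)"
      then obtain i where "i < n" "(a \<in> A i) \<noteq> (b \<in> A i)" by blast
      then show False
        using base4_code_gap[of "\<lambda>i. a \<in> A i" i "\<lambda>i. b \<in> A i" n] ab(1) unfolding h_def by linarith
    qed
    moreover have "dist x y \<le> dist a x + dist a b + dist b y"
      using dist_triangle[of x y a] dist_triangle[of a y b] by (simp add: dist_commute)
    ultimately show False using ab unfolding e_def by linarith
  qed
  define G where "G t = (THE x. (t, x) \<in> \<Gamma>)" for t
  have G: "G t = x" if "(t, x) \<in> \<Gamma>" for t x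
    unfolding G_def using that inj by blast
  have Gh: "G (h x) = x" for x
  proof (rule G)
    show "(h x, x) \<in> \<Gamma>" unfolding \<Gamma>_def using closure_subset by fast
  qed
  define C where "C = fst ` \<Gamma>"
  have "compact C" unfolding C_def using \<open>compact \<Gamma>\<close>
    by (intro compact_continuous_image continuous_intros)
  then have "closed C" by (rule compact_imp_closed)
  have hC: "h x \<in> C" for x
  proof -
    have "(h x, x) \<in> \<Gamma>" unfolding \<Gamma>_def using closure_subset by fast
    then show ?thesis unfolding C_def by force
  qed
  \<comment> \<open>\<open>fst\<close> is injective on the compact set \<open>\<Gamma>\<close>, so
    its inverse, which sends \<open>t\<close> to \<open>(t, G t)\<close>, is continuous.\<close>
  have contG: "continuous_on C G"
  proof -
    have "continuous_on (fst ` \<Gamma>) (\<lambda>t. (t, G t))"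
      using \<open>compact \<Gamma>\<close> G by (intro continuous_on_inv continuous_intros) auto
    from continuous_on_snd[OF this] show ?thesis unfolding C_def by simp
  qed
  \<comment> \<open>The constant value off the closed set \<open>C\<close> only serves Borel
    measurability; by \<open>AE_C\<close> below, the limit law \<open>M\<close> does not charge the
    complement of \<open>C\<close>.\<close>
  define G' where "G' t = (if t \<in> C then G t else undefined)" for t
  have G'_meas: "G' \<in> measurable borel borel"
    unfolding G'_def using contG \<open>closed C\<close>
    by (intro borel_measurable_continuous_on_if) (auto intro: borel_closed continuous_intros)
  define m where "m k = distr (\<mu> k) borel h" for k
  have h_meas': "h \<in> borel_measurable (\<mu> k)" for k
    using h_meas sets by (simp cong: measurable_cong_sets)
  have rd: "real_distribution (m k)" for k
    unfolding m_def using prob_space.real_distribution_distr[OF prob h_meas'] .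
  have "tight m"
    unfolding tight_def
  proof (intro conjI allI impI rd)
    fix e :: real assume "e > 0"
    have "measure (m k) {-1<..2} = 1" for k
    proof -
      have "h -` {-1<..2} \<inter> space (\<mu> k) = space (\<mu> k)"
      proof -
        have "-1 < h x" "h x \<le> 2" for x using h0[of x] h2[of x] by linarith+
        then show ?thesis by auto
      qed
      then show ?thesis
        unfolding m_def using h_meas' prob_space.prob_space[OF prob]
        by (subst measure_distr) auto
    qed
    then show "\<exists>a b. a < b \<and> (\<forall>n. 1 - e < measure (m n) {a<..b})"
      using \<open>e > 0\<close> by (intro exI[of _ "-1"] exI[of _ 2]) auto
  qed
  then obtain r M where r: "strict_mono (r :: nat \<Rightarrow> nat)" "real_distribution M" "weak_conv_m (m \<circ> id \<circ> r) M"
    using tight_imp_convergent_subsubsequence[of m id] by (auto simp: strict_mono_def)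
  interpret M: real_distribution M by fact
  have conv: "(\<lambda>k. \<integral>x. F (h x) \<partial>\<mu> (r k)) \<longlonglongrightarrow> (\<integral>t. F t \<partial>M)"
    if F: "continuous_on UNIV F" "\<And>t. \<bar>F t\<bar> \<le> B" for F :: "real \<Rightarrow> real" and B
  proof -
    have "(\<lambda>k. integral\<^sup>L ((m \<circ> id \<circ> r) k) F) \<longlonglongrightarrow> integral\<^sup>L M F"
      using F r rd
      by (intro weak_conv_imp_integral_bdd_continuous_conv[where B = B])
        (auto simp: continuous_on_eq_continuous_at comp_def)
    moreover have "integral\<^sup>L (m k) F = (\<integral>x. F (h x) \<partial>\<mu> k)" for k
      unfolding m_def using h_meas' borel_measurable_continuous_onI[OF F(1)] by (intro integral_distr)
    ultimately show ?thesis by simp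
  qed
  \<comment> \<open>All codes lie in \<open>C\<close>, so the distance to \<open>C\<close>
    integrates to 0 along the sequence and hence also under \<open>M\<close>. The truncation at 1
    makes it a bounded test function.\<close>
  have AE_C: "AE t in M. t \<in> C"
  proof -
    let ?F = "\<lambda>t. min 1 (infdist t C)"
    have cF: "continuous_on UNIV ?F" by (intro continuous_intros)
    have "(\<lambda>k. \<integral>x. ?F (h x) \<partial>\<mu> (r k)) \<longlonglongrightarrow> (\<integral>t. ?F t \<partial>M)"
      by (rule conv[OF cF, of 1]) (auto simp: infdist_nonneg)
    then have "(\<integral>t. ?F t \<partial>M) = 0"
      using hC by (simp add: LIMSEQ_const_iff)
    moreover have "integrable M ?F"
      using borel_measurable_continuous_onI[OF cF]
      by (intro M.integrable_const_bound[of _ 1]) (auto simp: infdist_nonneg)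
    ultimately have "AE t in M. ?F t = 0"
      by (subst (asm) integral_nonneg_eq_0_iff_AE) (auto simp: infdist_nonneg)
    moreover have "t \<in> C" if "?F t = 0" for t
      using that \<open>closed C\<close> in_closed_iff_infdist_zero[of C t] hC by (auto simp: min_def split: if_splits)
    ultimately show ?thesis by (rule eventually_mono)
  qed
  define \<nu> where "\<nu> = distr M borel G'"
  have G'_meas': "G' \<in> measurable M borel" using G'_meas by (simp add: measurable_def)
  show ?thesis
  proof (rule that[OF r(1), of \<nu>])
    show "prob_space \<nu>" unfolding \<nu>_def using G'_meas' by (rule M.prob_space_distr)
    show "sets \<nu> = sets borel" unfolding \<nu>_def by simp
    fix f :: "'a \<Rightarrow> real" assume f: "continuous_on UNIV f"
    obtain B where B: "B > 0" "\<And>x. \<bar>f x\<bar> \<le> B" using continuous_bounded_compact[OF cpt f] by blast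
    \<comment> \<open>\<open>f \<circ> G\<close> is continuous on \<open>C\<close> only, while weak
      convergence tests functions on the whole line; Tietze's theorem extends it with the same bound
      \<open>B\<close>.\<close>
    have "continuous_on C (f \<circ> G)"
      using contG f by (intro continuous_on_compose) (auto intro: continuous_on_subset)
    then obtain F where F: "continuous_on UNIV F" "\<And>t. t \<in> C \<Longrightarrow> F t = (f \<circ> G) t" "\<And>t. norm (F t) \<le> B"
      using Tietze[of C "f \<circ> G" UNIV B] B \<open>closed C\<close> by (metis UNIV_I closed_closedin comp_def less_imp_le real_norm_def subtopology_UNIV)
    have "(\<lambda>k. \<integral>x. F (h x) \<partial>\<mu> (r k)) \<longlonglongrightarrow> (\<integral>t. F t \<partial>M)"
      using F by (intro conv[of F B]) auto
    moreover have "F (h x) = f x" for x using F(2)[OF hC] Gh by simp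
    moreover have "(\<integral>t. F t \<partial>M) = (\<integral>x. f x \<partial>\<nu>)"
    proof -
      have "(\<integral>x. f x \<partial>\<nu>) = (\<integral>t. f (G' t) \<partial>M)"
        unfolding \<nu>_def using G'_meas' borel_measurable_continuous_onI[OF f] by (rule integral_distr)
      also have "\<dots> = (\<integral>t. F t \<partial>M)"
      proof (rule integral_cong_AE)
        show "(\<lambda>t. f (G' t)) \<in> borel_measurable M"
          using G'_meas' borel_measurable_continuous_on[OF f] by blast
        show "F \<in> borel_measurable M" using borel_measurable_continuous_onI[OF F(1)] by simp
        show "AE t in M. f (G' t) = F t"
          using AE_C by eventually_elim (simp add: F(2) G'_def)
      qed
      finally show ?thesis ..
    qed
    ultimately show "(\<lambda>k. \<integral>x. f x \<partial>\<mu> (r k)) \<longlonglongrightarrow> (\<integral>x. f x \<partial>\<nu>)" by simp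
  qed
qed

subsection \<open>Invariant measures from orbit averages\<close>

text \<open>The bounded continuous functions \<open>max 0 (1 - n * infdist x F)\<close> converge
  pointwise to the indicator of a closed set \<open>F\<close>. By dominated convergence the
  integrals determine the masses of closed sets, which form an intersection-stable generator of the
  Borel sets.\<close>

lemma finite_measure_eqI_continuous:
  fixes M N :: "'a::metric_space measure"
  assumes "finite_measure M" "finite_measure N" "sets M = sets borel" "sets N = sets borel"
    and eq: "\<And>f :: 'a \<Rightarrow> real. continuous_on UNIV f \<Longrightarrow> bounded (range f) \<Longrightarrow> (\<integral>x. f x \<partial>M) = (\<integral>x. f x \<partial>N)"
  shows "M = N"
proof -
  have lim: "(\<lambda>n. \<integral>x. max 0 (1 - real n * infdist x F) \<partial>K) \<longlonglongrightarrow> measure K F"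
    if "closed F" "F \<noteq> {}" "finite_measure K" "sets K = sets borel" for F :: "'a set" and K
  proof -
    interpret finite_measure K by fact
    have F: "F \<in> sets K" using that by simp
    have "(\<lambda>n. \<integral>x. max 0 (1 - real n * infdist x F) \<partial>K) \<longlonglongrightarrow> (\<integral>x. indicator F x \<partial>K)"
    proof (rule integral_dominated_convergence[where w = "\<lambda>_. 1"])
      show "(\<lambda>x. max 0 (1 - real n * infdist x F)) \<in> borel_measurable K" for n
      proof -
        have "continuous_on UNIV (\<lambda>x. max 0 (1 - real n * infdist x F))" by (intro continuous_intros)
        then show ?thesis using borel_measurable_continuous_onI that(4) by (simp cong: measurable_cong_sets)
      qed
      show "AE x in K. (\<lambda>n. max 0 (1 - real n * infdist x F)) \<longlonglongrightarrow> indicator F x"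
      proof (rule AE_I2)
        fix x
        show "(\<lambda>n. max 0 (1 - real n * infdist x F)) \<longlonglongrightarrow> indicator F x"
        proof (cases "x \<in> F")
          case True
          then show ?thesis by simp
        next
          case False
          then have pos: "infdist x F > 0"
            using that(1,2) in_closed_iff_infdist_zero[of F x] infdist_nonneg[of x F] by linarith
          obtain m where m: "1 < real m * infdist x F" using ex_less_of_nat_mult[OF pos] by blast
          have "max 0 (1 - real n * infdist x F) = 0" if "n \<ge> m" for n
          proof -
            have "real m * infdist x F \<le> real n * infdist x F" using that pos by (intro mult_right_mono) auto
            then show ?thesis using m by simp
          qed
          then have "eventually (\<lambda>n. max 0 (1 - real n * infdist x F) = indicator F x) sequentially"
            using False by (auto simp: eventually_sequentially)
          then show ?thesis by (rule tendsto_eventually)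
        qed
      qed
      show "AE x in K. norm (max 0 (1 - real n * infdist x F)) \<le> 1" for n
        by (rule AE_I2) (auto simp: infdist_nonneg)
    qed (use F in auto)
    then show ?thesis using F by simp
  qed
  interpret M: finite_measure M by fact
  interpret N: finite_measure N by fact
  show ?thesis
  proof (rule measure_eqI_generator_eq[where E = "Collect closed" and \<Omega> = UNIV and A = "\<lambda>_. UNIV"])
    show "Int_stable (Collect (closed :: 'a set \<Rightarrow> bool))" by (auto simp: Int_stable_def)
    show "sets M = sigma_sets UNIV (Collect closed)" "sets N = sigma_sets UNIV (Collect closed)"
      using assms(3,4) by (simp_all add: borel_eq_closed)
    fix F :: "'a set" assume "F \<in> Collect closed"
    then have F: "closed F" by simp
    show "emeasure M F = emeasure N F"
    \<comment> \<open>The empty set is treated apart because \<open>infdist x {}\<close> is 0 by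
      convention, which would make the approximating functions constantly 1.\<close>
    proof (cases "F = {}")
      case False
      have "(\<integral>x. max 0 (1 - real n * infdist x F) \<partial>M) = (\<integral>x. max 0 (1 - real n * infdist x F) \<partial>N)" for n
      proof (rule eq)
        show "continuous_on UNIV (\<lambda>x. max 0 (1 - real n * infdist x F))" by (intro continuous_intros)
        show "bounded (range (\<lambda>x. max 0 (1 - real n * infdist x F)))"
          by (rule boundedI[of _ 1]) (auto simp: infdist_nonneg)
      qed
      then have "measure M F = measure N F"
        using lim[OF F False assms(1,3)] lim[OF F False assms(2,4)] by (simp add: LIMSEQ_unique)
      then show ?thesis by (simp add: M.emeasure_eq_measure N.emeasure_eq_measure)
    qed simp
  qed auto
qed

lemma continuous_on_funpow:
  fixes T :: "'a::topological_space \<Rightarrow> 'a"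
  assumes "continuous_on UNIV T"
  shows "continuous_on UNIV (T ^^ n)"
proof (induction n)
  case (Suc n)
  have "continuous_on UNIV (T \<circ> T ^^ n)"
    using Suc assms by (intro continuous_on_compose) (auto intro: continuous_on_subset)
  then show ?case by simp
qed (simp add: id_def)

text \<open>The empirical measures of the first \<open>s k\<close> orbit points have a weak limit
  along a subsequence. Averages of \<open>f\<close> and of \<open>f\<close> after \<open>T\<close>
  differ by a telescoped boundary term of size at most \<open>2 * B\<close> divided by the length,
  so the limit is invariant. The lengths \<open>s\<close> are left free in order to be chosen later
  as multiples of a period.\<close>

theorem krylov_bogoliubov:
  fixes T :: "'a::metric_space \<Rightarrow> 'a"
  assumes "dynamical_system T" and s: "strict_mono s" "\<And>k. 0 < s k"
  obtains r \<nu> where "strict_mono (r :: nat \<Rightarrow> nat)" "\<nu> \<in> invariant_measures T"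
    "\<And>f :: 'a \<Rightarrow> real. continuous_on UNIV f \<Longrightarrow>
      (\<lambda>k. (\<Sum>i<s (r k). f ((T ^^ i) y)) / s (r k)) \<longlonglongrightarrow> (\<integral>x. f x \<partial>\<nu>)"
proof -
  have cpt: "compact (UNIV :: 'a set)" and contT: "continuous_on UNIV T"
    using assms(1) by (auto simp: dynamical_system_def)
  define \<mu> where "\<mu> k = distr (measure_pmf (pmf_of_set {..<s k})) borel (\<lambda>i. (T ^^ i) y)" for k
  have int\<mu>: "(\<integral>x. f x \<partial>\<mu> k) = (\<Sum>i<s k. f ((T ^^ i) y)) / s k" if "continuous_on UNIV f" for f :: "'a \<Rightarrow> real" and k
  proof -
    have "(\<integral>x. f x \<partial>\<mu> k) = (\<integral>i. f ((T ^^ i) y) \<partial>measure_pmf (pmf_of_set {..<s k}))"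
      unfolding \<mu>_def using borel_measurable_continuous_onI[OF that] by (intro integral_distr) auto
    also have "\<dots> = (\<Sum>i<s k. f ((T ^^ i) y)) / card {..<s k}"
      using s(2)[of k] by (intro integral_pmf_of_set) auto
    finally show ?thesis by simp
  qed
  have "prob_space (\<mu> k)" for k
    unfolding \<mu>_def by (intro prob_space.prob_space_distr prob_space_measure_pmf) auto
  moreover have "sets (\<mu> k) = sets borel" for k unfolding \<mu>_def by simp
  ultimately obtain r \<nu> where r: "strict_mono (r :: nat \<Rightarrow> nat)" and \<nu>: "prob_space \<nu>" "sets \<nu> = sets borel"
    and lim: "\<And>f :: 'a \<Rightarrow> real. continuous_on UNIV f \<Longrightarrow> (\<lambda>k. \<integral>x. f x \<partial>\<mu> (r k)) \<longlonglongrightarrow> (\<integral>x. f x \<partial>\<nu>)"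
    using weak_convergent_subsequence_compact[OF cpt, of \<mu>] by blast
  interpret prob_space \<nu> by fact
  have T_meas: "T \<in> measurable \<nu> borel"
    using borel_measurable_continuous_onI[OF contT] \<nu>(2) by (simp cong: measurable_cong_sets)
  have "(\<integral>x. f (T x) \<partial>\<nu>) = (\<integral>x. f x \<partial>\<nu>)" if f: "continuous_on UNIV f" for f :: "'a \<Rightarrow> real"
  proof -
    obtain B where B: "B > 0" "\<And>x. \<bar>f x\<bar> \<le> B" using continuous_bounded_compact[OF cpt f] by blast
    have fT: "continuous_on UNIV (\<lambda>x. f (T x))"
      using continuous_on_compose2[OF f contT] by simp
    have "(\<lambda>k. (\<integral>x. f (T x) \<partial>\<mu> (r k)) - (\<integral>x. f x \<partial>\<mu> (r k))) \<longlonglongrightarrow> 0"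
    proof (rule Lim_null_comparison)
      show "eventually (\<lambda>k. norm ((\<integral>x. f (T x) \<partial>\<mu> (r k)) - (\<integral>x. f x \<partial>\<mu> (r k))) \<le> 2 * B / s (r k)) sequentially"
      proof (rule always_eventually, rule allI)
        fix k
        let ?n = "s (r k)"
        have "(\<integral>x. f (T x) \<partial>\<mu> (r k)) - (\<integral>x. f x \<partial>\<mu> (r k))
          = (\<Sum>i<?n. f ((T ^^ Suc i) y) - f ((T ^^ i) y)) / ?n"
          unfolding int\<mu>[OF f] int\<mu>[OF fT] by (simp add: sum_subtractf diff_divide_distrib)
        also have "\<dots> = (f ((T ^^ ?n) y) - f y) / ?n"
          by (subst sum_lessThan_telescope) simp
        finally have "norm ((\<integral>x. f (T x) \<partial>\<mu> (r k)) - (\<integral>x. f x \<partial>\<mu> (r k))) = \<bar>f ((T ^^ ?n) y) - f y\<bar> / ?n"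
          by simp
        also have "\<dots> \<le> 2 * B / ?n"
          using B(2)[of "(T ^^ ?n) y"] B(2)[of y] by (intro divide_right_mono) auto
        finally show "norm ((\<integral>x. f (T x) \<partial>\<mu> (r k)) - (\<integral>x. f x \<partial>\<mu> (r k))) \<le> 2 * B / ?n" .
      qed
      have "strict_mono (s \<circ> r)" using s(1) r by (rule strict_mono_o)
      then have "filterlim (\<lambda>k. real (s (r k))) at_top sequentially"
        using filterlim_subseq filterlim_compose[OF filterlim_real_sequentially] by (auto simp: o_def)
      then show "(\<lambda>k. 2 * B / s (r k)) \<longlonglongrightarrow> 0"
        by (intro real_tendsto_divide_at_top[OF tendsto_const])
    qed
    moreover have "(\<lambda>k. (\<integral>x. f (T x) \<partial>\<mu> (r k)) - (\<integral>x. f x \<partial>\<mu> (r k))) \<longlonglongrightarrow> (\<integral>x. f (T x) \<partial>\<nu>) - (\<integral>x. f x \<partial>\<nu>)"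
      by (intro tendsto_diff lim f fT)
    ultimately have "(\<integral>x. f (T x) \<partial>\<nu>) - (\<integral>x. f x \<partial>\<nu>) = 0" using LIMSEQ_unique by blast
    then show ?thesis by simp
  qed
  then have "distr \<nu> borel T = \<nu>"
    using T_meas \<nu>(2)
    by (intro finite_measure_eqI_continuous finite_measure_distr)
      (auto simp: finite_measure_axioms integral_distr borel_measurable_continuous_onI)
  have "measure \<nu> (T -` A) = measure \<nu> A" if "A \<in> sets borel" for A
  proof -
    have "measure (distr \<nu> borel T) A = measure \<nu> (T -` A \<inter> space \<nu>)"
      using T_meas that by (rule measure_distr)
    moreover have "space \<nu> = UNIV" using sets_eq_imp_space_eq[OF \<nu>(2)] by simp
    ultimately show ?thesis using \<open>distr \<nu> borel T = \<nu>\<close> by simp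
  qed
  then have "\<nu> \<in> invariant_measures T" using \<nu> by (auto simp: invariant_measures_def)
  with r show ?thesis using that lim int\<mu> by simp
qed

text \<open>Along lengths that are multiples of \<open>N\<close> the orbit sums split into whole
  blocks, so a bound valid on every block survives in the limit. One \<open>\<nu>\<close> serves all
  \<open>f\<close> at once.\<close>

corollary invariant_measure_block_bound:
  fixes T :: "'a::metric_space \<Rightarrow> 'a"
  assumes "dynamical_system T" and "0 < N"
  obtains \<nu> where "\<nu> \<in> invariant_measures T"
    "\<And>(f :: 'a \<Rightarrow> real) a. continuous_on UNIV f \<Longrightarrow> (\<And>j. a * real N \<le> (\<Sum>i = j * N..<j * N + N. f ((T ^^ i) y))) \<Longrightarrow>
      a \<le> (\<integral>x. f x \<partial>\<nu>)"
    "\<And>(f :: 'a \<Rightarrow> real) a. continuous_on UNIV f \<Longrightarrow> (\<And>j. (\<Sum>i = j * N..<j * N + N. f ((T ^^ i) y)) \<le> a * real N) \<Longrightarrow>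
      (\<integral>x. f x \<partial>\<nu>) \<le> a"
proof -
  have "strict_mono (\<lambda>k. Suc k * N)" using assms(2) by (intro strict_monoI) simp
  moreover have "0 < Suc k * N" for k using assms(2) by simp
  ultimately obtain r \<nu> where r: "strict_mono (r :: nat \<Rightarrow> nat)" and \<nu>: "\<nu> \<in> invariant_measures T"
    and lim: "\<And>f :: 'a \<Rightarrow> real. continuous_on UNIV f \<Longrightarrow>
      (\<lambda>k. (\<Sum>i<Suc (r k) * N. f ((T ^^ i) y)) / (Suc (r k) * N)) \<longlonglongrightarrow> (\<integral>x. f x \<partial>\<nu>)"
    using krylov_bogoliubov[OF assms(1), of "\<lambda>k. Suc k * N" y] by blast
  have lower: "a \<le> (\<integral>x. f x \<partial>\<nu>)"
    if "continuous_on UNIV f" "\<And>j. a * real N \<le> (\<Sum>i = j * N..<j * N + N. f ((T ^^ i) y))"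
    for f :: "'a \<Rightarrow> real" and a
  proof (rule LIMSEQ_le_const[OF lim[OF that(1)]], intro exI allI impI)
    fix k
    have "(\<Sum>j<Suc (r k). a * real N) \<le> (\<Sum>j<Suc (r k). \<Sum>i = j * N..<j * N + N. f ((T ^^ i) y))"
      using that(2) by (rule sum_mono)
    also have "\<dots> = (\<Sum>i<Suc (r k) * N. f ((T ^^ i) y))" by (rule sum.nat_group)
    finally have "a * real (Suc (r k) * N) \<le> (\<Sum>i<Suc (r k) * N. f ((T ^^ i) y))"
      by (simp add: algebra_simps)
    moreover have "0 < Suc (r k) * N" using assms(2) by simp
    then have "0 < real (Suc (r k) * N)" by (rule of_nat_0_less_iff[THEN iffD2])
    ultimately show "a \<le> (\<Sum>i<Suc (r k) * N. f ((T ^^ i) y)) / (Suc (r k) * N)"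
      by (simp only: pos_le_divide_eq)
  qed
  show ?thesis
  proof (rule that[OF \<nu> lower])
    fix f :: "'a \<Rightarrow> real" and a assume "continuous_on UNIV f" "\<And>j. (\<Sum>i = j * N..<j * N + N. f ((T ^^ i) y)) \<le> a * real N"
    then show "(\<integral>x. f x \<partial>\<nu>) \<le> a"
      using lower[of "\<lambda>x. - f x" "- a"] by (simp add: sum_negf continuous_on_minus)
  qed
qed

subsection \<open>Periodic pseudo-orbits\<close>

text \<open>Finitely many balls of radius \<open>\<delta> / 2\<close> cover the space, transitivity
  provides one transit for each ordered pair of them, and \<open>M\<close> is the largest of these
  finitely many times. Since \<open>M\<close> does not depend on \<open>u\<close> and
  \<open>v\<close>, segments can afterwards be made long compared with the connectors.\<close>

lemma bounded_connectors:
  fixes T :: "'a::metric_space \<Rightarrow> 'a"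
  assumes "compact (UNIV :: 'a set)" "transitive_system T" "\<delta> > 0"
  obtains M where "\<And>u v. \<exists>z n. 0 < n \<and> n \<le> M \<and> dist u z < \<delta> \<and> dist ((T ^^ n) z) v < \<delta>"
proof -
  obtain C where C: "finite C" "(UNIV :: 'a set) \<subseteq> (\<Union>c\<in>C. ball c (\<delta> / 2))"
  proof (rule compactE_image[OF assms(1), of UNIV "\<lambda>c. ball c (\<delta> / 2)"])
    show "UNIV \<subseteq> (\<Union>c. ball c (\<delta> / 2))"
      using assms(3) by (auto intro!: exI[where P = "\<lambda>c. dist c _ < _"])
  qed auto
  have "\<exists>n z. 0 < n \<and> z \<in> ball c (\<delta> / 2) \<and> (T ^^ n) z \<in> ball d (\<delta> / 2)" for c d
  proof -
    have "\<exists>n>0. (T ^^ n) ` ball c (\<delta> / 2) \<inter> ball d (\<delta> / 2) \<noteq> {}"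
      using assms(2,3) unfolding transitive_system_def by simp
    then show ?thesis by blast
  qed
  then obtain n z where nz: "\<And>c d. 0 < n c d" "\<And>c d. z c d \<in> ball c (\<delta> / 2)"
    "\<And>c d. (T ^^ n c d) (z c d) \<in> ball d (\<delta> / 2)"
    by metis
  have *: "finite ((\<lambda>(c, d). n c d) ` (C \<times> C))" using C(1) by simp
  show ?thesis
  proof (rule that[of "Max ((\<lambda>(c, d). n c d) ` (C \<times> C))"])
    fix u v
    obtain c d where cd: "c \<in> C" "u \<in> ball c (\<delta> / 2)" "d \<in> C" "v \<in> ball d (\<delta> / 2)" using C(2) by blast
    have "n c d \<le> Max ((\<lambda>(c, d). n c d) ` (C \<times> C))"
      using cd by (intro Max_ge[OF *]) auto
    moreover have "dist u (z c d) < \<delta>"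
      using cd(2) nz(2)[of c d] by (auto intro: dist_triangle_half_r)
    moreover have "dist ((T ^^ n c d) (z c d)) v < \<delta>"
      using cd(4) nz(3)[of c d] by (auto intro: dist_triangle_half_r)
    ultimately show "\<exists>z' n'. 0 < n' \<and> n' \<le> Max ((\<lambda>(c, d). n c d) ` (C \<times> C)) \<and> dist u z' < \<delta> \<and> dist ((T ^^ n') z') v < \<delta>"
      using nz(1) by blast
  qed
qed

section \<open>Chains assembled from orbit segments\<close>

abbreviation orbit_segment :: "('a \<Rightarrow> 'a) \<Rightarrow> 'a \<Rightarrow> nat \<Rightarrow> 'a list" where
  "orbit_segment T x n \<equiv> map (\<lambda>i. (T ^^ i) x) [0..<n]"

lemma orbit_segment_chain:
  fixes T :: "'a::metric_space \<Rightarrow> 'a"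
  assumes "\<delta> > 0"
  shows "successively (\<lambda>a b. dist (T a) b < \<delta>) (orbit_segment T x n)"
  using assms by (simp add: successively_conv_nth)

lemma orbit_segment_last: "0 < n \<Longrightarrow> T (last (orbit_segment T x n)) = (T ^^ n) x"
  by (cases n) auto

lemma orbit_segment_hd: "0 < n \<Longrightarrow> hd (orbit_segment T x n) = x"
  by (simp add: hd_map)

lemma abs_sum_list_le:
  fixes f :: "'a \<Rightarrow> real"
  assumes "\<And>x. \<bar>f x\<bar> \<le> B"
  shows "\<bar>\<Sum>x\<leftarrow>xs. f x\<bar> \<le> B * length xs"
proof (induction xs)
  case (Cons x xs)
  then show ?case using assms[of x] by (simp add: algebra_simps)
qed simp

text \<open>By induction on \<open>ps\<close>, the segment of length \<open>L\<close> from
  \<open>p\<close> and a connector are put in front of the chain for the remaining points. Each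
  point of \<open>ps\<close> costs at most \<open>M\<close> extra entries, each contributing at most
  \<open>B\<close>. The end \<open>v\<close> stays fixed during the induction; the choice
  \<open>v = hd ps\<close> closes the chain.\<close>

lemma chain_through_orbit_segments:
  fixes T :: "'a::metric_space \<Rightarrow> 'a"
  assumes "\<delta> > 0" "0 < L"
    and conn: "\<And>u v. \<exists>z n. 0 < n \<and> n \<le> M \<and> dist u z < \<delta> \<and> dist ((T ^^ n) z) v < \<delta>"
  shows "\<exists>xs. successively (\<lambda>a b. dist (T a) b < \<delta>) xs \<and>
    (ps \<noteq> [] \<longrightarrow> xs \<noteq> [] \<and> hd xs = hd ps \<and> dist (T (last xs)) v < \<delta>) \<and>
    set ps \<subseteq> set xs \<and> L * length ps \<le> length xs \<and> length xs \<le> (L + M) * length ps \<and>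
    (\<forall>f B. (\<forall>x. \<bar>f x\<bar> \<le> B) \<longrightarrow>
      \<bar>(\<Sum>x\<leftarrow>xs. f x) - (\<Sum>p\<leftarrow>ps. \<Sum>i<L. f ((T ^^ i) p))\<bar> \<le> B * real (M * length ps))"
proof (induction ps)
  case Nil
  show ?case by (intro exI[of _ "[]"]) auto
next
  case (Cons p ps)
  let ?R = "\<lambda>a b. dist (T a) b < \<delta>"
  obtain xs where xs: "successively ?R xs"
    "ps \<noteq> [] \<Longrightarrow> xs \<noteq> [] \<and> hd xs = hd ps \<and> dist (T (last xs)) v < \<delta>"
    "set ps \<subseteq> set xs" "L * length ps \<le> length xs" "length xs \<le> (L + M) * length ps"
    "\<And>f B. (\<And>x. \<bar>f x\<bar> \<le> B) \<Longrightarrow>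
      \<bar>(\<Sum>x\<leftarrow>xs. f x) - (\<Sum>p\<leftarrow>ps. \<Sum>i<L. f ((T ^^ i) p))\<bar> \<le> B * real (M * length ps)"
    using Cons.IH by blast
  \<comment> \<open>The connector aims at the head of the remaining chain, or at \<open>v\<close>
    after the last segment.\<close>
  define w where "w = (if ps = [] then v else hd ps)"
  obtain z n where zn: "0 < n" "n \<le> M" "dist ((T ^^ L) p) z < \<delta>" "dist ((T ^^ n) z) w < \<delta>"
    using conn[of "(T ^^ L) p" w] by blast
  \<comment> \<open>The segments stop one step early, at \<open>(T ^^ (L - 1)) p\<close> and
    \<open>(T ^^ (n - 1)) z\<close>; the images of these points are \<open>(T ^^ L) p\<close> and
    \<open>(T ^^ n) z\<close>, so the inequalities in \<open>zn\<close> are exactly the two jump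
    conditions.\<close>
  let ?s = "orbit_segment T p L" and ?t = "orbit_segment T z n"
  let ?xs = "?s @ ?t @ xs"
  have ne: "?s \<noteq> []" "?t \<noteq> []" using assms(2) zn(1) by auto
  have [simp]: "xs = []" if "ps = []" using xs(5) that by simp
  have hd_ps: "hd ?s = p" using orbit_segment_hd[OF assms(2), of T p] by simp
  show ?case
  proof (intro exI[of _ ?xs] conjI allI impI)
    show "successively ?R ?xs"
      unfolding successively_append_iff[of _ ?s] successively_append_iff[of _ ?t]
      using orbit_segment_chain[OF assms(1), of T p L] orbit_segment_chain[OF assms(1), of T z n] xs(1,2)
        orbit_segment_last[OF assms(2), of T p] orbit_segment_last[OF zn(1), of T z]
        orbit_segment_hd[OF zn(1), of T z] zn(3,4) ne
      by (cases "ps = []") (auto simp: w_def simp del: map_is_Nil_conv)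
    show "?xs \<noteq> []" using ne by simp
    show "hd ?xs = hd (p # ps)" using hd_ps ne by simp
    show "dist (T (last ?xs)) v < \<delta>"
    proof (cases "ps = []")
      case True
      then show ?thesis using zn orbit_segment_last[OF zn(1), of T z] ne by (simp add: w_def)
    next
      case False
      then show ?thesis using xs(2) by simp
    qed
    show "set (p # ps) \<subseteq> set ?xs"
      using xs(3) hd_ps hd_in_set[OF ne(1)] by auto
    show "L * length (p # ps) \<le> length ?xs" using xs(4) by simp
    show "length ?xs \<le> (L + M) * length (p # ps)" using xs(5) zn(2) by (simp add: algebra_simps)
    fix f :: "'a \<Rightarrow> real" and B assume f: "\<forall>x. \<bar>f x\<bar> \<le> B"
    then have B: "0 \<le> B" by (meson abs_ge_zero order_trans)
    have "(\<Sum>x\<leftarrow>?s. f x) = (\<Sum>i<L. f ((T ^^ i) p))"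
      by (simp add: interv_sum_list_conv_sum_set_nat comp_def atLeast0LessThan)
    then have "(\<Sum>x\<leftarrow>?xs. f x) - (\<Sum>p\<leftarrow>p # ps. \<Sum>i<L. f ((T ^^ i) p))
      = (\<Sum>x\<leftarrow>?t. f x) + ((\<Sum>x\<leftarrow>xs. f x) - (\<Sum>p\<leftarrow>ps. \<Sum>i<L. f ((T ^^ i) p)))"
      by simp
    moreover have "\<bar>\<Sum>x\<leftarrow>?t. f x\<bar> \<le> B * real M"
    proof -
      have "\<bar>\<Sum>x\<leftarrow>?t. f x\<bar> \<le> B * real (length ?t)" using f by (intro abs_sum_list_le) auto
      also have "\<dots> \<le> B * real M" using zn(2) B by (intro mult_left_mono) auto
      finally show ?thesis .
    qed
    moreover have "\<bar>(\<Sum>x\<leftarrow>xs. f x) - (\<Sum>p\<leftarrow>ps. \<Sum>i<L. f ((T ^^ i) p))\<bar> \<le> B * real (M * length ps)"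
      using f by (intro xs(6)) auto
    ultimately have "\<bar>(\<Sum>x\<leftarrow>?xs. f x) - (\<Sum>p\<leftarrow>p # ps. \<Sum>i<L. f ((T ^^ i) p))\<bar>
      \<le> B * real M + B * real (M * length ps)"
      by linarith
    then show "\<bar>(\<Sum>x\<leftarrow>?xs. f x) - (\<Sum>p\<leftarrow>p # ps. \<Sum>i<L. f ((T ^^ i) p))\<bar> \<le> B * real (M * length (p # ps))"
      by (simp add: algebra_simps)
  qed
qed

lemma periodic_pseudo_orbit:
  fixes T :: "'a::metric_space \<Rightarrow> 'a"
  assumes "successively (\<lambda>a b. dist (T a) b < \<delta>) xs" "xs \<noteq> []" "dist (T (last xs)) (hd xs) < \<delta>"
  shows "pseudo_orbit T \<delta> (\<lambda>n. xs ! (n mod length xs))"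
  unfolding pseudo_orbit_def
proof
  fix n
  show "dist (T (xs ! (n mod length xs))) (xs ! (Suc n mod length xs)) < \<delta>"
  proof (cases "Suc (n mod length xs) = length xs")
    case True
    then have "n mod length xs = length xs - 1" "Suc n mod length xs = 0" by (auto simp: mod_Suc)
    then show ?thesis using assms(2,3) by (simp add: last_conv_nth hd_conv_nth)
  next
    case False
    moreover have "n mod length xs < length xs" using assms(2) by simp
    ultimately show ?thesis
      using successively_nth[OF assms(1), of "n mod length xs"] by (simp add: mod_Suc)
  qed
qed

lemma sum_periodic_block:
  fixes f :: "'a \<Rightarrow> real"
  shows "(\<Sum>i = j * length xs..<j * length xs + length xs. f (xs ! (i mod length xs))) = (\<Sum>x\<leftarrow>xs. f x)"
proof -
  have "(\<Sum>i = j * length xs..<j * length xs + length xs. f (xs ! (i mod length xs)))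
    = (\<Sum>i = 0..<length xs. f (xs ! ((i + j * length xs) mod length xs)))"
    using sum.shift_bounds_nat_ivl[of "\<lambda>i. f (xs ! (i mod length xs))" 0 "j * length xs" "length xs"]
    by (simp add: add.commute)
  also have "\<dots> = (\<Sum>i = 0..<length xs. f (xs ! i))" by (rule sum.cong) auto
  also have "\<dots> = (\<Sum>x\<leftarrow>xs. f x)" by (simp add: sum_list_sum_nth)
  finally show ?thesis .
qed

text \<open>Modelled on a sum of \<open>K\<close> terms of size at most \<open>B\<close> to which at
  most \<open>W\<close> terms are added. Half of the bound pays for the change of the sum, half for
  the change of the divisor. It serves both the rounding of weights and the connecting
  pieces.\<close>

lemma average_perturbation:
  fixes K N S E B W :: real
  assumes "0 < K" "K \<le> N" "N \<le> K + W" "\<bar>S' - S\<bar> \<le> B * W" "\<bar>S\<bar> \<le> B * K" "0 \<le> B"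
  shows "\<bar>S' / N - S / K\<bar> \<le> 2 * B * W / K"
proof -
  have "0 < N" "0 \<le> W" using assms by auto
  have "S' / N - S / K = (S' - S) / N - (S / K) * ((N - K) / N)"
    using \<open>0 < N\<close> assms(1) by (simp add: field_simps)
  also have "\<bar>\<dots>\<bar> \<le> \<bar>(S' - S) / N\<bar> + \<bar>(S / K) * ((N - K) / N)\<bar>" by (rule abs_triangle_ineq4)
  also have "\<dots> \<le> B * W / K + B * (W / K)"
  proof (rule add_mono)
    show "\<bar>(S' - S) / N\<bar> \<le> B * W / K"
      unfolding abs_divide using assms \<open>0 < N\<close> \<open>0 \<le> W\<close> by (intro frac_le) auto
    have "\<bar>S / K\<bar> \<le> B" using assms by (simp add: abs_divide divide_le_eq)
    moreover have "\<bar>(N - K) / N\<bar> \<le> W / K"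
      unfolding abs_divide using assms \<open>0 < N\<close> \<open>0 \<le> W\<close> by (intro frac_le) auto
    ultimately show "\<bar>(S / K) * ((N - K) / N)\<bar> \<le> B * (W / K)"
      unfolding abs_mult using assms(6) by (intro mult_mono) auto
  qed
  finally show ?thesis by simp
qed

subsection \<open>Approximation of integrals by point averages\<close>

lemma common_bound:
  fixes G :: "('a::topological_space \<Rightarrow> real) set"
  assumes "compact (UNIV :: 'a set)" "finite G" "\<forall>g\<in>G. continuous_on UNIV g"
  obtains B where "B > 0" "\<And>g x. g \<in> G \<Longrightarrow> \<bar>g x\<bar> \<le> B"
proof -
  have "\<exists>B>0. \<forall>g\<in>G. \<forall>x. \<bar>g x\<bar> \<le> B"
    using assms(2,3)
  proof (induction G rule: finite_induct)
    case empty
    then show ?case by (intro exI[of _ 1]) simp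
  next
    case (insert g G)
    then obtain B where B: "B > 0" "\<forall>g\<in>G. \<forall>x. \<bar>g x\<bar> \<le> B" by blast
    have "continuous_on UNIV g" using insert.prems by blast
    then obtain B' where B': "B' > 0" "\<And>x. \<bar>g x\<bar> \<le> B'"
      using continuous_bounded_compact[OF assms(1)] by blast
    show ?case
    proof (intro exI[of _ "max B B'"] conjI ballI allI)
      show "max B B' > 0" using B(1) by simp
      fix h x assume "h \<in> insert g G"
      then show "\<bar>h x\<bar> \<le> max B B'" using B(2) B'(2) by (auto simp: le_max_iff_disj)
    qed
  qed
  then show ?thesis using that by blast
qed

lemma common_modulus:
  fixes G :: "('a::metric_space \<Rightarrow> real) set"
  assumes "compact (UNIV :: 'a set)" "finite G" "\<forall>g\<in>G. continuous_on UNIV g" "\<eta> > 0"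
  obtains e where "e > 0" "\<And>g x y. g \<in> G \<Longrightarrow> dist x y < e \<Longrightarrow> \<bar>g x - g y\<bar> < \<eta>"
proof -
  have "\<exists>e>0. \<forall>g\<in>G. \<forall>x y. dist x y < e \<longrightarrow> \<bar>g x - g y\<bar> < \<eta>"
    using assms(2,3)
  proof (induction G rule: finite_induct)
    case empty
    then show ?case by (intro exI[of _ 1]) simp
  next
    case (insert g G)
    then obtain e where e: "e > 0" "\<forall>g\<in>G. \<forall>x y. dist x y < e \<longrightarrow> \<bar>g x - g y\<bar> < \<eta>" by blast
    have "uniformly_continuous_on UNIV g"
      using insert.prems assms(1) by (intro compact_uniformly_continuous) auto
    then obtain e' where e': "e' > 0" "\<And>x y. dist x y < e' \<Longrightarrow> \<bar>g x - g y\<bar> < \<eta>"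
      using assms(4) unfolding uniformly_continuous_on_def dist_real_def by (metis UNIV_I abs_minus_commute dist_commute)
    show ?case
    proof (intro exI[of _ "min e e'"] conjI ballI allI impI)
      show "min e e' > 0" using e(1) e'(1) by simp
      fix h and x y :: 'a assume "h \<in> insert g G" "dist x y < min e e'"
      then show "\<bar>h x - h y\<bar> < \<eta>" using e(2) e'(2) by auto
    qed
  qed
  then show ?thesis using that by blast
qed

text \<open>A finite cover by balls of radius \<open>e\<close>, a common modulus of continuity for
  \<open>G\<close>, is made disjoint, and each \<open>g\<close> is replaced on the cell
  \<open>P i\<close> by its value at the centre \<open>c i\<close>. The points of \<open>K\<close>
  are added to the centres so that they can be forced into a list of sample points. A cell may be
  empty and need not contain its centre.\<close>

lemma simple_approximation:
  fixes G :: "('a::metric_space \<Rightarrow> real) set"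
  assumes "compact (UNIV :: 'a set)" "finite G" "\<forall>g\<in>G. continuous_on UNIV g" "\<eta> > 0" "finite K"
  shows "\<exists>(q :: nat) P c. (\<forall>i. P i \<in> sets borel) \<and> K \<subseteq> c ` {..<q} \<and>
    (\<forall>x. (\<Sum>i<q. indicator (P i) x) = (1 :: real)) \<and>
    (\<forall>g\<in>G. \<forall>x. \<bar>g x - (\<Sum>i<q. g (c i) * indicator (P i) x)\<bar> < \<eta>)"
proof -
  obtain e where e: "e > 0" "\<And>g x y. g \<in> G \<Longrightarrow> dist x y < e \<Longrightarrow> \<bar>g x - g y\<bar> < \<eta>"
    using common_modulus[OF assms(1-4)] by blast
  obtain C where C: "finite C" "(UNIV :: 'a set) \<subseteq> (\<Union>c\<in>C. ball c e)"
  proof (rule compactE_image[OF assms(1), of UNIV "\<lambda>c. ball c e"])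
    show "UNIV \<subseteq> (\<Union>c. ball c e)" using e(1) by (auto intro!: exI[where P = "\<lambda>c. dist c _ < _"])
  qed auto
  obtain cs where cs: "set cs = C \<union> K" using finite_list[of "C \<union> K"] C(1) assms(5) by auto
  \<comment> \<open>\<open>disjointed\<close> acts on infinite sequences, so the finite family of
    balls is padded with empty sets.\<close>
  define A where "A i = (if i < length cs then ball (cs ! i) e else {})" for i
  define P where "P = disjointed A"
  have "range A \<subseteq> sets borel" unfolding A_def by auto
  then have "range P \<subseteq> sets borel" unfolding P_def by (rule sets.range_disjointed_sets)
  then have P_meas: "P i \<in> sets borel" for i by blast
  have ind: "\<exists>i<length cs. dist (cs ! i) x < e \<and> (\<forall>j. indicator (P j) x = (of_bool (j = i) :: real))" for x
  proof -
    obtain c where "c \<in> C" "x \<in> ball c e" using C(2) by blast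
    then obtain i where "i < length cs" "x \<in> A i"
      using cs unfolding A_def by (metis UnI1 in_set_conv_nth)
    then have "x \<in> (\<Union>i. P i)" unfolding P_def UN_disjointed_eq by blast
    then obtain i where i: "x \<in> P i" by blast
    then have "x \<in> A i" unfolding P_def using disjointed_subset[of A i] by blast
    then have "i < length cs" "dist (cs ! i) x < e" unfolding A_def by (auto split: if_splits)
    moreover have "x \<notin> P j" if "j \<noteq> i" for j
      using disjoint_family_onD[OF disjoint_family_disjointed[of A], of j i] that i unfolding P_def by auto
    then have "\<forall>j. indicator (P j) x = (of_bool (j = i) :: real)" using i by (metis indicator_simps of_bool_eq)
    ultimately show ?thesis by blast
  qed
  show ?thesis
  proof (intro exI[of _ "length cs"] exI[of _ P] exI[of _ "\<lambda>i. cs ! i"] conjI allI ballI)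
    show "P i \<in> sets borel" for i by (rule P_meas)
    show "K \<subseteq> (!) cs ` {..<length cs}" using cs by (auto simp: set_conv_nth image_def)
  next
    fix x
    obtain i where i: "i < length cs" "dist (cs ! i) x < e" "\<And>j. indicator (P j) x = (of_bool (j = i) :: real)"
      using ind by blast
    show "(\<Sum>i<length cs. indicator (P i) x) = (1 :: real)"
      unfolding i(3) using i(1) by (simp add: of_bool_def)
  next
    fix g and x :: 'a
    obtain i where i: "i < length cs" "dist (cs ! i) x < e" "\<And>j. indicator (P j) x = (of_bool (j = i) :: real)"
      using ind by blast
    assume "g \<in> G"
    have "(\<Sum>j<length cs. g (cs ! j) * indicator (P j) x) = g (cs ! i)"
    proof -
      have "(\<Sum>j<length cs. g (cs ! j) * indicator (P j) x) = (\<Sum>j<length cs. if j = i then g (cs ! j) else 0)"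
        unfolding i(3) by (rule sum.cong) auto
      then show ?thesis using i(1) by simp
    qed
    then show "\<bar>g x - (\<Sum>j<length cs. g (cs ! j) * indicator (P j) x)\<bar> < \<eta>"
      using e(2)[OF \<open>g \<in> G\<close>, of x "cs ! i"] i(2) by (simp add: dist_commute)
  qed
qed

lemma (in prob_space) abs_expectation_le:
  assumes "integrable M f" "\<And>x. \<bar>f x\<bar> \<le> (c :: real)"
  shows "\<bar>expectation f\<bar> \<le> c"
proof -
  have "f x \<le> c" "- c \<le> f x" for x using assms(2)[of x] by linarith+
  then have "expectation f \<le> c" "- c \<le> expectation f"
    using assms(1) by (auto intro: integral_le_const integral_ge_const)
  then show ?thesis by linarith
qed

text \<open>The cell masses \<open>w i\<close> are replaced by integer multiplicities
  \<open>k i\<close> near \<open>Q * w i\<close>. Rounding costs at most one per cell, hence at most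
  \<open>q\<close> in all, which is negligible against a large \<open>Q\<close>.\<close>

lemma finite_point_average:
  fixes G :: "('a::metric_space \<Rightarrow> real) set"
  assumes cpt: "compact (UNIV :: 'a set)" and \<mu>: "prob_space \<mu>" "sets \<mu> = sets borel"
    and G: "finite G" "\<forall>g\<in>G. continuous_on UNIV g" and "\<eta> > 0" "finite K"
  obtains ps where "ps \<noteq> []" "K \<subseteq> set ps"
    "\<And>g. g \<in> G \<Longrightarrow> \<bar>(\<Sum>p\<leftarrow>ps. g p) / length ps - (\<integral>x. g x \<partial>\<mu>)\<bar> < \<eta>"
proof -
  interpret prob_space \<mu> by fact
  have space: "space \<mu> = UNIV" using sets_eq_imp_space_eq[OF \<mu>(2)] by simp
  obtain B where B: "B > 0" "\<And>g x. g \<in> G \<Longrightarrow> \<bar>g x\<bar> \<le> B" using common_bound[OF cpt G] by blast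
  have "\<eta> / 2 > 0" using \<open>\<eta> > 0\<close> by simp
  obtain q :: nat and P c where P0: "\<forall>i. P i \<in> sets borel" "K \<subseteq> c ` {..<q}"
    "\<forall>x. (\<Sum>i<q. indicator (P i) x) = (1 :: real)"
    "\<forall>g\<in>G. \<forall>x. \<bar>g x - (\<Sum>i<q. g (c i) * indicator (P i) x)\<bar> < \<eta> / 2"
    using simple_approximation[OF cpt G \<open>\<eta> / 2 > 0\<close> \<open>finite K\<close>] by (elim exE conjE) (rule that)
  note P = P0(1)[rule_format] P0(2) P0(3)[rule_format] P0(4)[rule_format]
  have P': "P i \<in> sets \<mu>" for i using P(1) \<mu>(2) by simp
  have int_P: "integrable \<mu> (\<lambda>x. a * indicator (P i) x :: real)" for a i
    using P' by (intro integrable_mult_right) (simp add: emeasure_eq_measure)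
  define w where "w i = measure \<mu> (P i)" for i
  have int_s: "(\<integral>x. (\<Sum>i<q. a i * indicator (P i) x) \<partial>\<mu>) = (\<Sum>i<q. a i * w i)" for a :: "nat \<Rightarrow> real"
    using P' int_P by (subst Bochner_Integration.integral_sum) (auto simp: w_def space)
  have sum_w: "(\<Sum>i<q. w i) = 1"
    using int_s[of "\<lambda>_. 1"] P(3) by (simp add: prob_space)
  have q: "0 < q" using P(3) by (cases q) auto
  \<comment> \<open>By \<open>average_perturbation\<close> the rounding error is at most
    \<open>2 * B * q / Q\<close>, which this choice puts below \<open>\<eta> / 2\<close>; the other
    half is spent on the approximation by cells.\<close>
  obtain Q :: nat where Q: "4 * B * q / \<eta> < Q" using reals_Archimedean2 by blast
  moreover have "0 \<le> 4 * B * q / \<eta>" using B(1) \<open>\<eta> > 0\<close> by simp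
  ultimately have Q0: "0 < real Q" by linarith
  txt \<open>The summand \<open>1\<close> makes every centre \<open>c i\<close> occur in the list, even when \<open>w i = 0\<close>.\<close>
  define k where "k i = nat \<lfloor>Q * w i\<rfloor> + 1" for i
  have w0: "0 \<le> w i" for i unfolding w_def by simp
  have k: "Q * w i \<le> k i" "k i \<le> Q * w i + 1" for i
  proof -
    have "0 \<le> Q * w i" using w0 by simp
    then have "real (nat \<lfloor>Q * w i\<rfloor>) = of_int \<lfloor>Q * w i\<rfloor>" by simp
    then show "Q * w i \<le> k i" "k i \<le> Q * w i + 1" unfolding k_def by linarith+
  qed
  define ps where "ps = concat (map (\<lambda>i. replicate (k i) (c i)) [0..<q])"
  have sum_ps: "(\<Sum>p\<leftarrow>ps. g p) = (\<Sum>i<q. k i * g (c i))" for g :: "'a \<Rightarrow> real"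
  proof -
    have "(\<Sum>p\<leftarrow>concat (map (\<lambda>i. replicate (k i) (c i)) js). g p) = (\<Sum>i\<leftarrow>js. k i * g (c i))" for js
      by (induction js) (auto simp: sum_list_replicate)
    then show ?thesis
      unfolding ps_def by (simp add: interv_sum_list_conv_sum_set_nat atLeast0LessThan)
  qed
  have len_ps: "real (length ps) = (\<Sum>i<q. real (k i))"
    using sum_ps[of "\<lambda>_. 1"] by (simp add: sum_list_triv)
  have len1: "real Q \<le> length ps"
  proof -
    have "(\<Sum>i<q. Q * w i) \<le> (\<Sum>i<q. real (k i))" using k(1) by (rule sum_mono)
    then show ?thesis using sum_w len_ps by (simp add: sum_distrib_left[symmetric])
  qed
  have len2: "length ps \<le> real Q + q"
  proof -
    have "(\<Sum>i<q. real (k i)) \<le> (\<Sum>i<q. Q * w i + 1)" using k(2) by (rule sum_mono)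
    then show ?thesis using sum_w len_ps by (simp add: sum_distrib_left[symmetric] sum.distrib)
  qed
  show ?thesis
  proof (rule that[of ps])
    show "ps \<noteq> []" using len1 Q0 by auto
    have "set ps = c ` {..<q}" unfolding ps_def k_def by auto
    then show "K \<subseteq> set ps" using P(2) by simp
    fix g assume g: "g \<in> G"
    let ?S = "\<Sum>i<q. Q * w i * g (c i)"
    have "\<bar>(\<Sum>i<q. k i * g (c i)) - ?S\<bar> = \<bar>\<Sum>i<q. (k i - Q * w i) * g (c i)\<bar>"
      by (simp add: sum_subtractf left_diff_distrib)
    also have "\<dots> \<le> (\<Sum>i<q. 1 * B)"
    proof (rule sum_abs[THEN order_trans], rule sum_mono)
      fix i
      show "\<bar>(k i - Q * w i) * g (c i)\<bar> \<le> 1 * B"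
        unfolding abs_mult using k[of i] B(2)[OF g, of "c i"] by (intro mult_mono) auto
    qed
    finally have 1: "\<bar>(\<Sum>i<q. k i * g (c i)) - ?S\<bar> \<le> B * q" by (simp add: mult.commute)
    have "\<bar>?S\<bar> \<le> (\<Sum>i<q. Q * w i * B)"
    proof (rule sum_abs[THEN order_trans], rule sum_mono)
      fix i
      show "\<bar>Q * w i * g (c i)\<bar> \<le> Q * w i * B"
        unfolding abs_mult using w0[of i] B(2)[OF g, of "c i"] by (intro mult_mono) auto
    qed
    also have "\<dots> = B * Q" using sum_w by (simp add: sum_distrib_left[symmetric] sum_distrib_right[symmetric])
    finally have 2: "\<bar>?S\<bar> \<le> B * Q" .
    have "\<bar>(\<Sum>p\<leftarrow>ps. g p) / length ps - ?S / Q\<bar> \<le> 2 * B * q / Q"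
      unfolding sum_ps using 1 2 Q0 len1 len2 B(1) by (intro average_perturbation) auto
    also have "\<dots> < \<eta> / 2" using Q Q0 \<open>\<eta> > 0\<close> by (simp add: field_simps)
    finally have "\<bar>(\<Sum>p\<leftarrow>ps. g p) / length ps - (\<Sum>i<q. g (c i) * w i)\<bar> < \<eta> / 2"
      using Q0 by (simp add: sum_divide_distrib mult.commute)
    moreover have "\<bar>(\<integral>x. g x \<partial>\<mu>) - (\<Sum>i<q. g (c i) * w i)\<bar> \<le> \<eta> / 2"
    proof -
      have ig: "integrable \<mu> g"
        by (rule integrable_continuous_compact[OF cpt G(2)[rule_format, OF g] finite_measure_axioms \<mu>(2)])
      have ii: "integrable \<mu> (\<lambda>x. \<Sum>i<q. g (c i) * indicator (P i) x)"
        by (rule Bochner_Integration.integrable_sum) (rule int_P)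
      have "(\<integral>x. g x \<partial>\<mu>) - (\<Sum>i<q. g (c i) * w i) = (\<integral>x. g x - (\<Sum>i<q. g (c i) * indicator (P i) x) \<partial>\<mu>)"
        using ig ii int_s[of "\<lambda>i. g (c i)"] by (subst Bochner_Integration.integral_diff) auto
      also have "\<bar>\<dots>\<bar> \<le> \<eta> / 2"
        using P(4)[OF g] by (intro abs_expectation_le Bochner_Integration.integrable_diff ig ii) (auto intro: less_imp_le)
      finally show ?thesis .
    qed
    ultimately show "\<bar>(\<Sum>p\<leftarrow>ps. g p) / length ps - (\<integral>x. g x \<partial>\<mu>)\<bar> < \<eta>" by linarith
  qed
qed

section \<open>Integrals against invariant measures\<close>

lemma invariant_measuresD:
  assumes "\<mu> \<in> invariant_measures T"
  shows "prob_space \<mu>" "sets \<mu> = sets borel" "space \<mu> = UNIV"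
  using assms sets_eq_imp_space_eq[of \<mu> borel] by (auto simp: invariant_measures_def)

lemma integral_funpow_invariant:
  fixes T :: "'a::topological_space \<Rightarrow> 'a" and g :: "'a \<Rightarrow> real"
  assumes "continuous_on UNIV T" "\<mu> \<in> invariant_measures T" "continuous_on UNIV g"
  shows "(\<integral>x. g ((T ^^ i) x) \<partial>\<mu>) = (\<integral>x. g x \<partial>\<mu>)"
  using assms(3)
proof (induction i arbitrary: g)
  case (Suc i)
  note \<mu> = invariant_measuresD[OF assms(2)]
  interpret prob_space \<mu> by (rule \<mu>(1))
  have T_meas: "T \<in> measurable \<mu> borel"
    using borel_measurable_continuous_onI[OF assms(1)] \<mu>(2) by (simp cong: measurable_cong_sets)
  have "distr \<mu> borel T = \<mu>"
  proof (rule measure_eqI)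
    fix A assume "A \<in> sets (distr \<mu> borel T)"
    then have A: "A \<in> sets borel" by simp
    then have "emeasure (distr \<mu> borel T) A = emeasure \<mu> (T -` A)"
      using T_meas \<mu>(3) by (simp add: emeasure_distr)
    then show "emeasure (distr \<mu> borel T) A = emeasure \<mu> A"
      using assms(2) A by (simp add: emeasure_eq_measure invariant_measures_def)
  qed (use \<mu> in simp)
  moreover have "(\<integral>x. g x \<partial>distr \<mu> borel T) = (\<integral>x. g (T x) \<partial>\<mu>)"
    using T_meas borel_measurable_continuous_onI[OF Suc.prems] by (rule integral_distr)
  moreover have "(\<integral>x. g (T ((T ^^ i) x)) \<partial>\<mu>) = (\<integral>x. g (T x) \<partial>\<mu>)"
    using continuous_on_compose2[OF Suc.prems assms(1)] by (intro Suc.IH) simp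
  ultimately show ?case by simp
qed simp

subsection \<open>Density of nearly rigid measures\<close>

text \<open>The estimates on \<open>G\<close> place \<open>\<nu>\<close> in a prescribed weak*
  neighbourhood of \<open>\<mu>\<close>. The time \<open>N\<close> is the period of the shadowed
  pseudo-orbit. The variance is only claimed to be positive, since the lower bound found for it
  shrinks as \<open>N\<close> grows.\<close>

lemma near_rigid_measure_dense:
  fixes T :: "'a::metric_space \<Rightarrow> 'a" and f :: "'a \<Rightarrow> real"
  assumes ds: "dynamical_system T" and trans: "transitive_system T" and shad: "shadowing_property T"
    and \<mu>: "\<mu> \<in> invariant_measures T"
    and G: "finite G" "\<forall>g\<in>G. continuous_on UNIV g"
    and f: "continuous_on UNIV f" "f x0 \<noteq> f x1" and "\<eta> > 0"
  obtains \<nu> N where "\<nu> \<in> invariant_measures T" "m \<le> N"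
    "\<And>g. g \<in> G \<Longrightarrow> \<bar>(\<integral>x. g x \<partial>\<nu>) - (\<integral>x. g x \<partial>\<mu>)\<bar> < \<eta>"
    "\<bar>(\<integral>x. f x * f ((T ^^ N) x) - (f x)\<^sup>2 \<partial>\<nu>)\<bar> \<le> \<eta>"
    "0 < (\<integral>x. (f x - (\<integral>x. f x \<partial>\<nu>))\<^sup>2 \<partial>\<nu>)"
proof -
  have cpt: "compact (UNIV :: 'a set)" and contT: "continuous_on UNIV T"
    using ds by (auto simp: dynamical_system_def)
  note \<mu>' = invariant_measuresD[OF \<mu>]
  have G': "finite (insert f G)" "\<forall>g\<in>insert f G. continuous_on UNIV g" using G f(1) by auto
  obtain B where B: "B > 0" "\<And>g x. g \<in> insert f G \<Longrightarrow> \<bar>g x\<bar> \<le> B"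
    using common_bound[OF cpt G'] by blast
  define d where "d = \<bar>f x0 - f x1\<bar>"
  have "d > 0" using f(2) by (simp add: d_def)
  \<comment> \<open>Three demands on the tracing error: \<open>\<eta> / 4\<close> for the integrals
    of \<open>G\<close>, \<open>\<eta> / B\<close> for the correlation, and \<open>d / 4\<close> to
    keep the values of \<open>f\<close> near \<open>x0\<close> and \<open>x1\<close> apart.\<close>
  define \<theta> where "\<theta> = min (\<eta> / 4) (min (\<eta> / B) (d / 4))"
  have \<theta>: "\<theta> > 0" "\<theta> \<le> \<eta> / 4" "B * \<theta> \<le> \<eta>" "\<theta> \<le> d / 4"
  proof -
    show "\<theta> > 0" using \<open>\<eta> > 0\<close> B(1) \<open>d > 0\<close> by (simp add: \<theta>_def)
    show "\<theta> \<le> \<eta> / 4" "\<theta> \<le> d / 4" unfolding \<theta>_def by linarith+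
    have "\<theta> \<le> \<eta> / B" unfolding \<theta>_def by linarith
    then show "B * \<theta> \<le> \<eta>" using B(1) by (simp add: field_simps)
  qed
  obtain e where e: "e > 0" "\<And>g x y. g \<in> insert f G \<Longrightarrow> dist x y < e \<Longrightarrow> \<bar>g x - g y\<bar> < \<theta>"
    using common_modulus[OF cpt G' \<theta>(1)] by blast
  \<comment> \<open>Tracing within \<open>e / 2\<close> makes any two orbit points that follow the
    same entry \<open>e\<close>-close to each other.\<close>
  obtain \<delta> where \<delta>: "\<delta> > 0" "\<And>x. pseudo_orbit T \<delta> x \<Longrightarrow> \<exists>y. traced_by T (e / 2) x y"
    using shad e(1) unfolding shadowing_property_def by (meson half_gt_zero)
  obtain M where M: "\<And>u v. \<exists>z n. 0 < n \<and> n \<le> M \<and> dist u z < \<delta> \<and> dist ((T ^^ n) z) v < \<delta>"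
    using bounded_connectors[OF cpt trans \<delta>(1)] by blast
  \<comment> \<open>\<open>L\<close> is chosen after \<open>M\<close>: it makes the share of the
    connectors in the averages negligible, and \<open>m \<le> L\<close> yields
    \<open>m \<le> N\<close>.\<close>
  obtain L where L: "0 < L" "m \<le> L" "2 * B * M / L \<le> \<eta> / 4"
  proof -
    obtain L' :: nat where L': "8 * B * M / \<eta> < L'" using reals_Archimedean2 by blast
    define L where "L = max (max L' m) 1"
    have "8 * B * M / \<eta> \<le> L" "0 < L" "m \<le> L" using L' unfolding L_def by linarith+
    moreover from this have "2 * B * M / L \<le> \<eta> / 4" using \<open>\<eta> > 0\<close> by (simp add: field_simps)
    ultimately show ?thesis using that by blast
  qed
  \<comment> \<open>By invariance \<open>A g\<close> and \<open>g\<close> have the same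
    \<open>\<mu>\<close>-integral, while a point average of \<open>A g\<close> is an average of
    \<open>g\<close> over orbit segments of length \<open>L\<close>.\<close>
  define A where "A g x = (\<Sum>i<L. g ((T ^^ i) x)) / L" for g :: "'a \<Rightarrow> real" and x
  have cont_pow: "continuous_on UNIV (\<lambda>x. g ((T ^^ i) x))" if "continuous_on UNIV g" for g :: "'a \<Rightarrow> real" and i
    using continuous_on_compose2[OF that continuous_on_funpow[OF contT, of i]] by simp
  have contA: "continuous_on UNIV (A g)" if "continuous_on UNIV g" for g
    unfolding A_def using cont_pow[OF that] L(1) by (intro continuous_intros) auto
  have "finite_measure \<mu>" using \<mu>'(1) by (rule prob_space.axioms)
  have int_A: "(\<integral>x. A g x \<partial>\<mu>) = (\<integral>x. g x \<partial>\<mu>)" if g: "continuous_on UNIV g" for g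
  proof -
    have "(\<integral>x. A g x \<partial>\<mu>) = (\<Sum>i<L. (\<integral>x. g ((T ^^ i) x) \<partial>\<mu>)) / L"
      unfolding A_def using integrable_continuous_compact[OF cpt cont_pow[OF g] \<open>finite_measure \<mu>\<close> \<mu>'(2)]
      by (simp add: Bochner_Integration.integral_sum)
    then show ?thesis using L(1) integral_funpow_invariant[OF contT \<mu> g] by simp
  qed
  txt \<open>Forcing \<open>x0\<close> and \<open>x1\<close> into the list \<open>ps\<close> keeps \<open>f\<close> from being constant \<open>\<nu>\<close>-almost everywhere.\<close>
  have "finite (A ` G)" "\<forall>g\<in>A ` G. continuous_on UNIV g" using G contA by auto
  moreover have "\<eta> / 4 > 0" "finite {x0, x1}" using \<open>\<eta> > 0\<close> by auto
  ultimately obtain ps where ps: "ps \<noteq> []" "{x0, x1} \<subseteq> set ps"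
    "\<And>g. g \<in> A ` G \<Longrightarrow> \<bar>(\<Sum>p\<leftarrow>ps. g p) / length ps - (\<integral>x. g x \<partial>\<mu>)\<bar> < \<eta> / 4"
    using finite_point_average[OF cpt \<mu>'(1,2), of "A ` G" "\<eta> / 4" "{x0, x1}"] by blast
  obtain xs where xs: "successively (\<lambda>a b. dist (T a) b < \<delta>) xs"
    "ps \<noteq> [] \<Longrightarrow> xs \<noteq> [] \<and> hd xs = hd ps \<and> dist (T (last xs)) (hd ps) < \<delta>"
    "set ps \<subseteq> set xs" "L * length ps \<le> length xs" "length xs \<le> (L + M) * length ps"
    "\<And>f B. (\<And>x. \<bar>f x\<bar> \<le> B) \<Longrightarrow>
      \<bar>(\<Sum>x\<leftarrow>xs. f x) - (\<Sum>p\<leftarrow>ps. \<Sum>i<L. f ((T ^^ i) p))\<bar> \<le> B * real (M * length ps)"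
    using chain_through_orbit_segments[OF \<delta>(1) L(1) M, of ps "hd ps"] by blast
  define N where "N = length xs"
  have "0 < N" using xs(2)[OF ps(1)] by (simp add: N_def)
  have "m \<le> N"
  proof -
    have "L * 1 \<le> L * length ps" using ps(1) by (intro mult_left_mono) (auto simp: Suc_le_eq)
    then show ?thesis using xs(4) L(2) unfolding N_def by linarith
  qed
  have "pseudo_orbit T \<delta> (\<lambda>n. xs ! (n mod N))"
    unfolding N_def using xs(1,2) ps(1) by (intro periodic_pseudo_orbit) auto
  then obtain y where y: "\<And>n. dist ((T ^^ n) y) (xs ! (n mod N)) < e / 2"
    using \<delta>(2) unfolding traced_by_def by blast
  have close: "\<bar>g ((T ^^ n) y) - g (xs ! (n mod N))\<bar> < \<theta>" if "g \<in> insert f G" for g n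
    using y[of n] e(1) by (intro e(2)[OF that]) linarith
  obtain \<nu> where \<nu>: "\<nu> \<in> invariant_measures T"
    and lower: "\<And>(f :: 'a \<Rightarrow> real) a. continuous_on UNIV f \<Longrightarrow>
      (\<And>j. a * real N \<le> (\<Sum>i = j * N..<j * N + N. f ((T ^^ i) y))) \<Longrightarrow> a \<le> (\<integral>x. f x \<partial>\<nu>)"
    and upper: "\<And>(f :: 'a \<Rightarrow> real) a. continuous_on UNIV f \<Longrightarrow>
      (\<And>j. (\<Sum>i = j * N..<j * N + N. f ((T ^^ i) y)) \<le> a * real N) \<Longrightarrow> (\<integral>x. f x \<partial>\<nu>) \<le> a"
    using invariant_measure_block_bound[OF ds \<open>0 < N\<close>, of y] by blast
  show ?thesis
  proof (rule that[OF \<nu> \<open>m \<le> N\<close>])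
    fix g assume g: "g \<in> G"
    then have g': "continuous_on UNIV g" "g \<in> insert f G" using G(2) by auto
    define S where "S = (\<Sum>x\<leftarrow>xs. g x)"
    \<comment> \<open>Each block of length \<open>N\<close> traces exactly one full period of
      \<open>xs\<close>.\<close>
    have block: "\<bar>(\<Sum>i = j * N..<j * N + N. g ((T ^^ i) y)) - S\<bar> \<le> \<theta> * real N" for j
    proof -
      have "(\<Sum>i = j * N..<j * N + N. g ((T ^^ i) y)) - S
        = (\<Sum>i = j * N..<j * N + N. g ((T ^^ i) y) - g (xs ! (i mod N)))"
        unfolding S_def N_def by (simp add: sum_subtractf sum_periodic_block)
      also have "\<bar>\<dots>\<bar> \<le> (\<Sum>i = j * N..<j * N + N. \<theta>)"
        using close[OF g'(2)] by (intro sum_abs[THEN order_trans] sum_mono less_imp_le)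
      finally show ?thesis by (simp add: mult.commute)
    qed
    have "\<bar>(\<integral>x. g x \<partial>\<nu>) - S / N\<bar> \<le> \<theta>"
    proof -
      have "S / N - \<theta> \<le> (\<integral>x. g x \<partial>\<nu>)"
      proof (rule lower[OF g'(1)])
        fix j
        have "(S / N - \<theta>) * N = S - \<theta> * N" using \<open>0 < N\<close> by (simp add: field_simps)
        then show "(S / N - \<theta>) * N \<le> (\<Sum>i = j * N..<j * N + N. g ((T ^^ i) y))"
          using block[of j] by linarith
      qed
      moreover have "(\<integral>x. g x \<partial>\<nu>) \<le> S / N + \<theta>"
      proof (rule upper[OF g'(1)])
        fix j
        have "(S / N + \<theta>) * N = S + \<theta> * N" using \<open>0 < N\<close> by (simp add: field_simps)
        then show "(\<Sum>i = j * N..<j * N + N. g ((T ^^ i) y)) \<le> (S / N + \<theta>) * N"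
          using block[of j] by linarith
      qed
      ultimately show ?thesis by linarith
    qed
    \<comment> \<open>Second of three errors of at most \<open>\<eta> / 4\<close>: tracing
      (\<open>\<theta>\<close>), connectors, and replacing \<open>\<mu>\<close> by the points of
      \<open>ps\<close>.\<close>
    moreover have "\<bar>S / N - (\<Sum>p\<leftarrow>ps. A g p) / length ps\<bar> \<le> \<eta> / 4"
    proof -
      let ?S = "\<Sum>p\<leftarrow>ps. \<Sum>i<L. g ((T ^^ i) p)" and ?q = "real (length ps)"
      have "0 < ?q" using ps(1) by simp
      have "\<bar>\<Sum>i<L. g ((T ^^ i) p)\<bar> \<le> B * L" for p
      proof -
        have "\<bar>\<Sum>i<L. g ((T ^^ i) p)\<bar> \<le> (\<Sum>i<L. B)"
          using B(2)[OF g'(2)] by (intro sum_abs[THEN order_trans] sum_mono)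
        then show ?thesis by (simp add: mult.commute)
      qed
      then have "\<bar>?S\<bar> \<le> B * L * ?q" by (rule abs_sum_list_le)
      moreover have "\<bar>S - ?S\<bar> \<le> B * (M * ?q)"
        unfolding S_def using xs(6)[of g B] B(2)[OF g'(2)] by simp
      moreover have "real (L * length ps) \<le> N" "real N \<le> real ((L + M) * length ps)"
        using xs(4,5) unfolding N_def by (simp_all only: of_nat_le_iff)
      ultimately have "\<bar>S / N - ?S / (L * ?q)\<bar> \<le> 2 * B * (M * ?q) / (L * ?q)"
        using \<open>0 < ?q\<close> L(1) B(1) by (intro average_perturbation) (auto simp: algebra_simps)
      also have "\<dots> = 2 * B * M / L" using \<open>0 < ?q\<close> by simp
      also have "?S / (L * ?q) = (\<Sum>p\<leftarrow>ps. A g p) / ?q"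
      proof -
        have "(\<Sum>p\<leftarrow>ps. A g p) = ?S / L"
          unfolding A_def by (induction ps) (auto simp: add_divide_distrib)
        then show ?thesis by simp
      qed
      finally show ?thesis using L(3) by linarith
    qed
    moreover have "\<bar>(\<Sum>p\<leftarrow>ps. A g p) / length ps - (\<integral>x. g x \<partial>\<mu>)\<bar> < \<eta> / 4"
      using ps(3)[of "A g"] g int_A[OF g'(1)] by simp
    ultimately show "\<bar>(\<integral>x. g x \<partial>\<nu>) - (\<integral>x. g x \<partial>\<mu>)\<bar> < \<eta>" using \<theta>(2) \<open>\<eta> > 0\<close> by linarith
  next
    define h where "h x = f x * f ((T ^^ N) x) - (f x)\<^sup>2" for x
    have cont_h: "continuous_on UNIV h"
      unfolding h_def using f(1) cont_pow[OF f(1)] by (intro continuous_intros)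
    \<comment> \<open>The times \<open>i\<close> and \<open>N + i\<close> follow the same entry of
      the periodic pseudo-orbit, so \<open>T ^^ N\<close> moves every point of the orbit of
      \<open>y\<close> by less than \<open>e\<close>.\<close>
    have h: "\<bar>h ((T ^^ i) y)\<bar> \<le> \<eta>" for i
    proof -
      have "dist ((T ^^ (N + i)) y) (xs ! (i mod N)) < e / 2" using y[of "N + i"] by simp
      then have "dist ((T ^^ (N + i)) y) ((T ^^ i) y) < e" using y by (rule dist_triangle_half_l)
      then have "\<bar>f ((T ^^ (N + i)) y) - f ((T ^^ i) y)\<bar> \<le> \<theta>" using e(2)[of f] less_imp_le by blast
      moreover have "h ((T ^^ i) y) = f ((T ^^ i) y) * (f ((T ^^ (N + i)) y) - f ((T ^^ i) y))"
        unfolding h_def by (simp add: funpow_add power2_eq_square algebra_simps)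
      moreover have "\<bar>f ((T ^^ i) y)\<bar> \<le> B" using B(2) by simp
      ultimately have "\<bar>h ((T ^^ i) y)\<bar> \<le> B * \<theta>"
        using B(1) by (simp only: abs_mult) (intro mult_mono abs_ge_zero, simp_all)
      then show ?thesis using \<theta>(3) by linarith
    qed
    have "(\<integral>x. h x \<partial>\<nu>) \<le> \<eta>"
    proof (rule upper[OF cont_h])
      fix j
      have "(\<Sum>i = j * N..<j * N + N. h ((T ^^ i) y)) \<le> (\<Sum>i = j * N..<j * N + N. \<eta>)"
        using h by (intro sum_mono) (simp add: abs_le_iff)
      then show "(\<Sum>i = j * N..<j * N + N. h ((T ^^ i) y)) \<le> \<eta> * N" by (simp add: mult.commute)
    qed
    moreover have "- \<eta> \<le> (\<integral>x. h x \<partial>\<nu>)"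
    proof (rule lower[OF cont_h])
      fix j
      have "(\<Sum>i = j * N..<j * N + N. - \<eta>) \<le> (\<Sum>i = j * N..<j * N + N. h ((T ^^ i) y))"
        using h by (intro sum_mono) (simp add: abs_le_iff minus_le_iff)
      then show "- \<eta> * N \<le> (\<Sum>i = j * N..<j * N + N. h ((T ^^ i) y))" by (simp add: mult.commute)
    qed
    ultimately show "\<bar>(\<integral>x. f x * f ((T ^^ N) x) - (f x)\<^sup>2 \<partial>\<nu>)\<bar> \<le> \<eta>"
      unfolding h_def by linarith
  next
    define a where "a = (\<integral>x. f x \<partial>\<nu>)"
    define V where "V x = (f x - a)\<^sup>2" for x
    have cont_V: "continuous_on UNIV V" unfolding V_def using f(1) by (intro continuous_intros)
    obtain i0 i1 where i: "i0 < N" "xs ! i0 = x0" "i1 < N" "xs ! i1 = x1"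
      using ps(2) xs(3) unfolding N_def by (metis insert_subset in_set_conv_nth subsetD)
    then have "i0 \<noteq> i1" using f(2) by auto
    \<comment> \<open>Each block visits points close to \<open>x0\<close> and \<open>x1\<close>,
      where the values of \<open>f\<close> differ by at least \<open>d / 2\<close>; they cannot both
      be near \<open>a\<close>. The constant comes from \<open>(u - v)\<^sup>2 \<le> 2 * ((u -
      a)\<^sup>2 + (v - a)\<^sup>2)\<close>.\<close>
    have V: "d\<^sup>2 / 8 \<le> V ((T ^^ (j * N + i0)) y) + V ((T ^^ (j * N + i1)) y)" for j
    proof -
      let ?u = "f ((T ^^ (j * N + i0)) y)" and ?v = "f ((T ^^ (j * N + i1)) y)"
      have "\<bar>?u - f x0\<bar> < \<theta>" "\<bar>?v - f x1\<bar> < \<theta>"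
        using close[of f "j * N + i0"] close[of f "j * N + i1"] i by simp_all
      moreover have "d \<le> \<bar>?u - f x0\<bar> + \<bar>?u - ?v\<bar> + \<bar>?v - f x1\<bar>" unfolding d_def by arith
      ultimately have "d / 2 \<le> \<bar>?u - ?v\<bar>" using \<theta>(4) by linarith
      then have "(d / 2)\<^sup>2 \<le> \<bar>?u - ?v\<bar>\<^sup>2" using \<open>d > 0\<close> by (intro power_mono) auto
      also have "\<dots> \<le> 2 * ((?u - a)\<^sup>2 + (?v - a)\<^sup>2)"
        using zero_le_power2[of "?u + ?v - 2 * a"] by (simp add: power2_eq_square algebra_simps)
      finally show ?thesis unfolding V_def by (simp add: power_divide)
    qed
    \<comment> \<open>Among the \<open>N\<close> nonnegative terms of a block only the two visits
      are kept, whence the factor \<open>1 / N\<close>.\<close>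
    have "d\<^sup>2 / (8 * N) \<le> (\<integral>x. V x \<partial>\<nu>)"
    proof (rule lower[OF cont_V])
      fix j
      have "d\<^sup>2 / (8 * N) * N = d\<^sup>2 / 8" using \<open>0 < N\<close> by simp
      also have "\<dots> \<le> (\<Sum>i\<in>{j * N + i0, j * N + i1}. V ((T ^^ i) y))"
        using V[of j] \<open>i0 \<noteq> i1\<close> by simp
      also have "\<dots> \<le> (\<Sum>i = j * N..<j * N + N. V ((T ^^ i) y))"
        using i by (intro sum_mono2) (auto simp: V_def)
      finally show "d\<^sup>2 / (8 * N) * N \<le> (\<Sum>i = j * N..<j * N + N. V ((T ^^ i) y))" .
    qed
    moreover have "0 < d\<^sup>2 / (8 * N)" using \<open>d > 0\<close> \<open>0 < N\<close> by simp
    ultimately show "0 < (\<integral>x. (f x - (\<integral>x. f x \<partial>\<nu>))\<^sup>2 \<partial>\<nu>)"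
      unfolding V_def a_def by linarith
  qed
qed

subsection \<open>Correlations, the weak* topology and category\<close>

text \<open>Mixing is given for sets. It extends at once to a simple function \<open>s\<close>,
  whose correlations are finite sums of set correlations, and then to \<open>f\<close> because
  \<open>s\<close> is uniformly close to \<open>f\<close> and the resulting errors are uniform in
  \<open>k\<close>.\<close>

lemma strongly_mixing_continuous:
  fixes T :: "'a::metric_space \<Rightarrow> 'a" and f :: "'a \<Rightarrow> real"
  assumes ds: "dynamical_system T" and \<mu>: "\<mu> \<in> strongly_mixing_measures T" and f: "continuous_on UNIV f"
  shows "(\<lambda>k. \<integral>x. f x * f ((T ^^ k) x) \<partial>\<mu>) \<longlonglongrightarrow> (\<integral>x. f x \<partial>\<mu>)\<^sup>2"
proof (rule LIMSEQ_I)
  fix r :: real assume "r > 0"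
  have cpt: "compact (UNIV :: 'a set)" and contT: "continuous_on UNIV T"
    using ds by (auto simp: dynamical_system_def)
  have inv: "\<mu> \<in> invariant_measures T" using \<mu> by (simp add: strongly_mixing_measures_def)
  note \<mu>' = invariant_measuresD[OF inv]
  interpret prob_space \<mu> by (rule \<mu>'(1))
  obtain B where B: "B > 0" "\<And>x. \<bar>f x\<bar> \<le> B" using continuous_bounded_compact[OF cpt f] by blast
  \<comment> \<open>\<open>\<eta> \<le> 1\<close> bounds \<open>s\<close> by \<open>B + 1\<close>;
    replacing \<open>f\<close> by \<open>s\<close> in a product then costs at most
    \<open>B * \<eta> + (B + 1) * \<eta>\<close>, which is at most \<open>r / 3\<close>.\<close>
  define \<eta> where "\<eta> = min 1 (r / (3 * (2 * B + 1)))"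
  have \<eta>: "\<eta> > 0" "\<eta> \<le> 1" using B(1) \<open>r > 0\<close> by (simp_all add: \<eta>_def)
  have "\<eta> * (2 * B + 1) \<le> r / 3"
  proof -
    have "\<eta> \<le> r / (3 * (2 * B + 1))" by (simp add: \<eta>_def)
    then have "\<eta> * (2 * B + 1) \<le> r / (3 * (2 * B + 1)) * (2 * B + 1)"
      using B(1) by (intro mult_right_mono) auto
    also have "\<dots> = r / 3"
    proof -
      have "r / (3 * D) * D = r / 3" if "D > 0" for D :: real using that by simp
      then show ?thesis using B(1) by (simp only: add_pos_pos mult_pos_pos zero_less_numeral zero_less_one)
    qed
    finally show ?thesis .
  qed
  obtain q :: nat and P c where P0: "\<forall>i. P i \<in> sets borel" "({} :: 'a set) \<subseteq> c ` {..<q}"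
    "\<forall>x. (\<Sum>i<q. indicator (P i) x) = (1 :: real)"
    "\<forall>g\<in>{f}. \<forall>x. \<bar>g x - (\<Sum>i<q. g (c i) * indicator (P i) x)\<bar> < \<eta>"
    using simple_approximation[OF cpt, of "{f}" \<eta> "{}"] f \<eta>(1) by auto
  note P = P0(1)[rule_format]
  define s where "s x = (\<Sum>i<q. f (c i) * indicator (P i) x)" for x
  have fs: "\<bar>f x - s x\<bar> \<le> \<eta>" for x using P0(4) by (auto simp: s_def intro: less_imp_le)
  have product_close: "\<bar>f x * f y - s x * s y\<bar> \<le> r / 3" for x y
  proof -
    have "f x * f y - s x * s y = f x * (f y - s y) + s y * (f x - s x)" by (simp add: algebra_simps)
    also have "\<bar>\<dots>\<bar> \<le> \<bar>f x\<bar> * \<bar>f y - s y\<bar> + \<bar>s y\<bar> * \<bar>f x - s x\<bar>"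
      by (metis abs_mult abs_triangle_ineq)
    also have "\<dots> \<le> B * \<eta> + (B + 1) * \<eta>"
    proof (rule add_mono; rule mult_mono)
      show "\<bar>s y\<bar> \<le> B + 1" using fs[of y] B(2)[of y] \<eta>(2) by linarith
    qed (use B fs in auto)
    also have "\<dots> = \<eta> * (2 * B + 1)" by (simp add: algebra_simps)
    finally show ?thesis using \<open>\<eta> * (2 * B + 1) \<le> r / 3\<close> by linarith
  qed
  have T_meas: "T ^^ k \<in> measurable \<mu> borel" for k
    using borel_measurable_continuous_onI[OF continuous_on_funpow[OF contT]] \<mu>'(2)
    by (simp cong: measurable_cong_sets)
  have f_meas: "f \<in> borel_measurable borel" using f by (rule borel_measurable_continuous_onI)
  have s_meas: "s \<in> borel_measurable borel" unfolding s_def using P by measurable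
  have id_meas: "(\<lambda>x. x) \<in> measurable \<mu> borel" using \<mu>'(2) by (simp cong: measurable_cong_sets)
  have int2: "integrable \<mu> (\<lambda>x. u x * u ((T ^^ k) x))"
    if "u \<in> borel_measurable borel" "\<And>x. \<bar>u x\<bar> \<le> C" for u :: "'a \<Rightarrow> real" and C k
  proof (rule integrable_const_bound[of _ "C * C"])
    show "(\<lambda>x. u x * u ((T ^^ k) x)) \<in> borel_measurable \<mu>"
      using measurable_compose[OF id_meas that(1)] measurable_compose[OF T_meas that(1)] by measurable
    have "0 \<le> C" using that(2) by (meson abs_ge_zero order_trans)
    then show "AE x in \<mu>. norm (u x * u ((T ^^ k) x)) \<le> C * C"
      using that(2) by (intro AE_I2) (simp add: abs_mult mult_mono)
  qed
  have s_bound: "\<bar>s x\<bar> \<le> B + 1" for x using fs[of x] B(2)[of x] \<eta>(2) by linarith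
  have close2: "\<bar>(\<integral>x. f x * f ((T ^^ k) x) \<partial>\<mu>) - (\<integral>x. s x * s ((T ^^ k) x) \<partial>\<mu>)\<bar> \<le> r / 3" for k
  proof -
    note ints = int2[OF f_meas B(2), of k] int2[OF s_meas s_bound, of k]
    have "(\<integral>x. f x * f ((T ^^ k) x) \<partial>\<mu>) - (\<integral>x. s x * s ((T ^^ k) x) \<partial>\<mu>)
      = (\<integral>x. f x * f ((T ^^ k) x) - s x * s ((T ^^ k) x) \<partial>\<mu>)"
      by (rule Bochner_Integration.integral_diff[OF ints, symmetric])
    also have "\<bar>\<dots>\<bar> \<le> r / 3"
      by (rule abs_expectation_le[OF Bochner_Integration.integrable_diff[OF ints] product_close])
    finally show ?thesis .
  qed
  have Pk: "P i \<inter> (T ^^ k) -` P j \<in> sets \<mu>" for i j k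
    using measurable_sets[OF T_meas P, of k j] P \<mu>'(2,3) by (intro sets.Int) auto
  have int_s: "(\<integral>x. s x \<partial>\<mu>) = (\<Sum>i<q. f (c i) * measure \<mu> (P i))"
  proof -
    have "integrable \<mu> (\<lambda>x. f (c i) * indicator (P i) x)" for i
      using P \<mu>'(2) by (intro integrable_mult_right) (simp add: emeasure_eq_measure)
    then show ?thesis
      unfolding s_def using P \<mu>'(2,3) by (subst Bochner_Integration.integral_sum) auto
  qed
  have int_ss: "(\<integral>x. s x * s ((T ^^ k) x) \<partial>\<mu>)
    = (\<Sum>i<q. \<Sum>j<q. f (c i) * f (c j) * measure \<mu> (P i \<inter> (T ^^ k) -` P j))" for k
  proof -
    have "s x * s ((T ^^ k) x) = (\<Sum>i<q. \<Sum>j<q. f (c i) * f (c j) * indicator (P i \<inter> (T ^^ k) -` P j) x)" for x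
      unfolding s_def sum_product by (intro sum.cong refl) (auto simp: indicator_def)
    then have "(\<integral>x. s x * s ((T ^^ k) x) \<partial>\<mu>)
      = (\<integral>x. (\<Sum>i<q. \<Sum>j<q. f (c i) * f (c j) * indicator (P i \<inter> (T ^^ k) -` P j) x) \<partial>\<mu>)"
      by (rule Bochner_Integration.integral_cong[OF refl])
    also have "\<dots> = (\<Sum>i<q. \<Sum>j<q. \<integral>x. f (c i) * f (c j) * indicator (P i \<inter> (T ^^ k) -` P j) x \<partial>\<mu>)"
    proof -
      have ints: "integrable \<mu> (\<lambda>x. f (c i) * f (c j) * indicator (P i \<inter> (T ^^ k) -` P j) x)" for i j
        using Pk by (intro integrable_mult_right) (simp add: emeasure_eq_measure)
      show ?thesis
        by (subst Bochner_Integration.integral_sum; (intro Bochner_Integration.integrable_sum ints sum.cong refl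
          Bochner_Integration.integral_sum)?)
    qed
    finally show ?thesis using Pk \<mu>'(3) by simp
  qed
  have "(\<lambda>k. \<integral>x. s x * s ((T ^^ k) x) \<partial>\<mu>)
    \<longlonglongrightarrow> (\<Sum>i<q. \<Sum>j<q. f (c i) * f (c j) * (measure \<mu> (P i) * measure \<mu> (P j)))"
    unfolding int_ss using \<mu> P by (intro tendsto_intros) (auto simp: strongly_mixing_measures_def)
  also have "(\<Sum>i<q. \<Sum>j<q. f (c i) * f (c j) * (measure \<mu> (P i) * measure \<mu> (P j))) = (\<integral>x. s x \<partial>\<mu>)\<^sup>2"
    unfolding int_s power2_eq_square sum_product by (simp add: algebra_simps)
  finally obtain K where K: "\<And>k. k \<ge> K \<Longrightarrow> \<bar>(\<integral>x. s x * s ((T ^^ k) x) \<partial>\<mu>) - (\<integral>x. s x \<partial>\<mu>)\<^sup>2\<bar> < r / 3"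
    using \<open>r > 0\<close> unfolding LIMSEQ_iff by (metis divide_pos_pos real_norm_def zero_less_numeral)
  have "\<bar>(\<integral>x. f x \<partial>\<mu>)\<^sup>2 - (\<integral>x. s x \<partial>\<mu>)\<^sup>2\<bar> \<le> r / 3"
  proof -
    let ?a = "\<integral>x. f x \<partial>\<mu>" and ?b = "\<integral>x. s x \<partial>\<mu>"
    have fi: "integrable \<mu> f"
      by (rule integrable_continuous_compact[OF cpt f finite_measure_axioms \<mu>'(2)])
    have si: "integrable \<mu> s"
      using s_bound measurable_compose[OF id_meas s_meas] by (intro integrable_const_bound[of _ "B + 1"]) auto
    have "\<bar>?a - ?b\<bar> \<le> \<eta>"
      using abs_expectation_le[OF Bochner_Integration.integrable_diff[OF fi si] fs] fi si by simp
    moreover have "\<bar>?a\<bar> \<le> B" "\<bar>?b\<bar> \<le> B + 1"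
      using abs_expectation_le[OF fi B(2)] abs_expectation_le[OF si s_bound] by auto
    moreover have "?a\<^sup>2 - ?b\<^sup>2 = (?a - ?b) * (?a + ?b)" by (simp add: power2_eq_square algebra_simps)
    ultimately have "\<bar>?a\<^sup>2 - ?b\<^sup>2\<bar> \<le> \<eta> * (2 * B + 1)"
      by (simp only: abs_mult) (intro mult_mono, auto)
    then show ?thesis using \<open>\<eta> * (2 * B + 1) \<le> r / 3\<close> by linarith
  qed
  then have "\<bar>(\<integral>x. f x * f ((T ^^ k) x) \<partial>\<mu>) - (\<integral>x. f x \<partial>\<mu>)\<^sup>2\<bar> < r" if "k \<ge> K" for k
    using K[OF that] close2[of k] by linarith
  then show "\<exists>K. \<forall>k\<ge>K. norm ((\<integral>x. f x * f ((T ^^ k) x) \<partial>\<mu>) - (\<integral>x. f x \<partial>\<mu>)\<^sup>2) < r"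
    by auto
qed

text \<open>Induction over the generation of the topology: an intersection merges the two finite
  families of test functions and takes the smaller tolerance, a union inherits both from one member
  containing \<open>\<mu>\<close>, and a subbasic set uses its single function.\<close>

lemma weak_star_neighbourhood:
  assumes "openin (weak_star_topology T) U" "\<mu> \<in> U"
  obtains G \<eta> where "finite G" "\<forall>g\<in>G. continuous_on UNIV (g :: 'a::topological_space \<Rightarrow> real)" "\<eta> > 0"
    "\<And>\<nu>. \<nu> \<in> invariant_measures T \<Longrightarrow> (\<And>g. g \<in> G \<Longrightarrow> \<bar>(\<integral>x. g x \<partial>\<nu>) - (\<integral>x. g x \<partial>\<mu>)\<bar> < \<eta>) \<Longrightarrow> \<nu> \<in> U"
proof -
  define near where "near G \<eta> U \<longleftrightarrow> (\<forall>\<nu>\<in>invariant_measures T.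
    (\<forall>g\<in>G. \<bar>(\<integral>x. g x \<partial>\<nu>) - (\<integral>x. g x \<partial>\<mu>)\<bar> < \<eta>) \<longrightarrow> \<nu> \<in> U)"
    for G :: "('a \<Rightarrow> real) set" and \<eta> U
  have "\<exists>G \<eta>. finite G \<and> (\<forall>g\<in>G. continuous_on UNIV (g :: 'a \<Rightarrow> real)) \<and> \<eta> > 0 \<and> near G \<eta> U"
    using openin_topology_generated_by[OF assms(1)[unfolded weak_star_topology_def]] assms(2)
  proof (induction rule: generate_topology_on.induct)
    case (Int a b)
    then obtain G \<eta> G' \<eta>' where
      G: "finite G" "\<forall>g\<in>G. continuous_on UNIV g" "\<eta> > 0" "near G \<eta> a" and
      G': "finite G'" "\<forall>g\<in>G'. continuous_on UNIV g" "\<eta>' > 0" "near G' \<eta>' b"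
      by blast
    have "near (G \<union> G') (min \<eta> \<eta>') (a \<inter> b)" using G(4) G'(4) by (simp add: near_def)
    then show ?case using G G'
      by (intro exI[of _ "G \<union> G'"] exI[of _ "min \<eta> \<eta>'"]) (auto simp del: min_less_iff_conj)
  next
    case (UN K)
    then obtain k where "k \<in> K" "\<mu> \<in> k" by blast
    then obtain G \<eta> where G: "finite G" "\<forall>g\<in>G. continuous_on UNIV g" "\<eta> > 0" "near G \<eta> k"
      using UN.IH by blast
    have "near G \<eta> (\<Union>K)" using G(4) \<open>k \<in> K\<close> unfolding near_def by (meson UnionI)
    then show ?case using G by blast
  next
    case (Basis s)
    then obtain f :: "'a \<Rightarrow> real" and W where s: "s = {\<nu> \<in> invariant_measures T. (\<integral>x. f x \<partial>\<nu>) \<in> W}"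
      "continuous_on UNIV f" "open W" by (elim CollectE exE conjE) (rule that; assumption)
    then obtain \<eta> where "\<eta> > 0" "\<And>t. \<bar>t - (\<integral>x. f x \<partial>\<mu>)\<bar> < \<eta> \<Longrightarrow> t \<in> W"
      using Basis.prems unfolding open_real by (auto simp: open_dist dist_real_def)
    then show ?case using s by (intro exI[of _ "{f}"] exI[of _ \<eta>]) (auto simp: near_def)
  qed simp
  then obtain G \<eta> where G: "finite G" "\<forall>g\<in>G. continuous_on UNIV g" "\<eta> > 0" "near G \<eta> U" by blast
  show ?thesis
    by (rule that[OF G(1-3)]) (use G(4) in \<open>simp add: near_def\<close>)
qed

lemma continuous_map_weak_star_integral:
  fixes f :: "'a::topological_space \<Rightarrow> real"
  assumes "continuous_on UNIV f"
  shows "continuous_map (weak_star_topology T) euclideanreal (\<lambda>\<mu>. \<integral>x. f x \<partial>\<mu>)"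
  unfolding continuous_map_def topspace_weak_star_topology
proof (intro conjI allI impI)
  fix W :: "real set" assume "openin euclideanreal W"
  then have "open W" by simp
  then show "openin (weak_star_topology T) {\<mu> \<in> invariant_measures T. (\<integral>x. f x \<partial>\<mu>) \<in> W}"
    unfolding weak_star_topology_def using assms by (intro topology_generated_by_Basis) blast
qed simp

section \<open>Nowhere dense sets and countable unions\<close>

lemma nowhere_dense_inI:
  assumes "N \<subseteq> E" "closedin X E" "\<And>U x. openin X U \<Longrightarrow> x \<in> U \<Longrightarrow> \<exists>y\<in>U. y \<notin> E"
  shows "nowhere_dense_in X N"
proof -
  have "X closure_of N \<subseteq> E" using assms(1,2) by (rule closure_of_minimal)
  then have "X interior_of (X closure_of N) \<subseteq> E"
    using interior_of_subset order_trans by metis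
  then have "X interior_of (X closure_of N) = {}"
    using assms(3)[OF openin_interior_of] by blast
  then show ?thesis
    using assms(1) closedin_subset[OF assms(2)] by (auto simp: nowhere_dense_in_def)
qed

lemma first_category_in_countable_Union:
  assumes "countable \<N>" "\<And>N. N \<in> \<N> \<Longrightarrow> nowhere_dense_in X N"
  shows "first_category_in X (\<Union>\<N>)"
proof -
  have "nowhere_dense_in X {}" by (simp add: nowhere_dense_in_def)
  \<comment> \<open>Inserting the empty set changes no union and lets \<open>from_nat_into\<close>
    enumerate a nonempty family even when \<open>\<N>\<close> is empty.\<close>
  have "nowhere_dense_in X (from_nat_into (insert {} \<N>) n)" for n
  proof -
    have "from_nat_into (insert {} \<N>) n \<in> insert {} \<N>" by (rule from_nat_into) simp
    then show ?thesis using \<open>nowhere_dense_in X {}\<close> assms(2) by (elim insertE) simp_all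
  qed
  moreover have "(\<Union>n. from_nat_into (insert {} \<N>) n) = \<Union>\<N>"
    using range_from_nat_into[of "insert {} \<N>"] assms(1) by simp
  ultimately show ?thesis unfolding first_category_in_def by metis
qed

theorem proposition3p9:
  fixes T :: "'a::metric_space \<Rightarrow> 'a"
  assumes "dynamical_system T"
    and "\<exists>x y :: 'a. x \<noteq> y"
    and "transitive_system T"
    and "shadowing_property T"
  shows "first_category_in (weak_star_topology T) (strongly_mixing_measures T)"
proof -
  let ?X = "weak_star_topology T"
  have cpt: "compact (UNIV :: 'a set)" and contT: "continuous_on UNIV T"
    using assms(1) by (auto simp: dynamical_system_def)
  obtain x0 x1 :: 'a where "x0 \<noteq> x1" using assms(2) by blast
  \<comment> \<open>Nontriviality of the space enters here: \<open>f\<close> vanishes at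
    \<open>x0\<close> but not at \<open>x1\<close>.\<close>
  define f where "f x = dist x x0" for x
  have f: "continuous_on UNIV f" "f x0 \<noteq> f x1"
    unfolding f_def using \<open>x0 \<noteq> x1\<close> by (auto intro: continuous_intros)
  have cont_fT: "continuous_on UNIV (\<lambda>x. f x * f ((T ^^ k) x))" for k
    using continuous_on_compose2[OF f(1) continuous_on_funpow[OF contT, of k]] f(1)
    by (intro continuous_on_mult) auto
  have cont_f2: "continuous_on UNIV (\<lambda>x. (f x)\<^sup>2)" using f(1) by (intro continuous_intros)
  \<comment> \<open>Variance of \<open>f\<close> and, below, its autocovariance at time
    \<open>k\<close>, written through integrals of continuous functions so that both are weak*
    continuous in \<open>\<mu>\<close>.\<close>
  define V where "V \<mu> = (\<integral>x. (f x)\<^sup>2 \<partial>\<mu>) - (\<integral>x. f x \<partial>\<mu>)\<^sup>2" for \<mu>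
  define R where "R k \<mu> = (\<integral>x. f x * f ((T ^^ k) x) \<partial>\<mu>) - (\<integral>x. f x \<partial>\<mu>)\<^sup>2" for k \<mu>
  have int: "integrable \<mu> g" if "\<mu> \<in> invariant_measures T" "continuous_on UNIV g" for \<mu> and g :: "'a \<Rightarrow> real"
    using invariant_measuresD[OF that(1)] that(2) cpt
    by (intro integrable_continuous_compact) (auto intro: prob_space.axioms)
  have V_eq: "(\<integral>x. (f x - (\<integral>x. f x \<partial>\<mu>))\<^sup>2 \<partial>\<mu>) = V \<mu>" if "\<mu> \<in> invariant_measures T" for \<mu>
  proof -
    interpret prob_space \<mu> using that by (rule invariant_measuresD)
    show ?thesis unfolding V_def using int[OF that] f(1) cont_f2 by (intro variance_eq) auto
  qed
  have V_nonneg: "0 \<le> V \<mu>" if "\<mu> \<in> invariant_measures T" for \<mu>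
    using V_eq[OF that] by (metis integral_nonneg_AE always_eventually zero_le_power2)
  have contV: "continuous_map ?X euclideanreal V"
    unfolding V_def using f(1) cont_f2
    by (intro continuous_map_diff continuous_map_real_pow continuous_map_weak_star_integral)
  have contR: "continuous_map ?X euclideanreal (R k)" for k
    unfolding R_def using f(1) cont_fT
    by (intro continuous_map_diff continuous_map_real_pow continuous_map_weak_star_integral)
  have closed: "closedin ?X {\<mu> \<in> invariant_measures T. h \<mu> \<in> C}"
    if "continuous_map ?X euclideanreal h" "closed C" for h C
    using closedin_continuous_map_preimage[OF that(1), of C] that(2) topspace_weak_star_topology[of T] by simp
  have approx: "\<exists>\<nu>\<in>U. \<nu> \<in> invariant_measures T \<and> 0 < V \<nu> \<and> (\<exists>N\<ge>m. \<bar>R N \<nu> - V \<nu>\<bar> < \<epsilon>)"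
    if U: "openin ?X U" "\<mu> \<in> U" and "\<epsilon> > 0" for U \<mu> m \<epsilon>
  proof -
    obtain G \<eta> where G: "finite G" "\<forall>g\<in>G. continuous_on UNIV (g :: 'a \<Rightarrow> real)" "\<eta> > 0"
      "\<And>\<nu>. \<nu> \<in> invariant_measures T \<Longrightarrow> (\<And>g. g \<in> G \<Longrightarrow> \<bar>(\<integral>x. g x \<partial>\<nu>) - (\<integral>x. g x \<partial>\<mu>)\<bar> < \<eta>) \<Longrightarrow> \<nu> \<in> U"
      using weak_star_neighbourhood[OF U] by blast
    have \<mu>: "\<mu> \<in> invariant_measures T"
      using openin_subset[OF U(1)] U(2) topspace_weak_star_topology[of T] by blast
    have "min \<eta> (\<epsilon> / 2) > 0" using G(3) \<open>\<epsilon> > 0\<close> by simp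
    then obtain \<nu> N where \<nu>: "\<nu> \<in> invariant_measures T" "m \<le> N"
      "\<And>g. g \<in> G \<Longrightarrow> \<bar>(\<integral>x. g x \<partial>\<nu>) - (\<integral>x. g x \<partial>\<mu>)\<bar> < min \<eta> (\<epsilon> / 2)"
      "\<bar>(\<integral>x. f x * f ((T ^^ N) x) - (f x)\<^sup>2 \<partial>\<nu>)\<bar> \<le> min \<eta> (\<epsilon> / 2)"
      "0 < (\<integral>x. (f x - (\<integral>x. f x \<partial>\<nu>))\<^sup>2 \<partial>\<nu>)"
      using near_rigid_measure_dense[OF assms(1,3,4) \<mu> G(1,2) f, of "min \<eta> (\<epsilon> / 2)" m] by blast
    have "\<nu> \<in> U" using \<nu>(1,3) by (intro G(4)) auto
    \<comment> \<open>The squared means cancel, leaving the integral controlled by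
      near-rigidity.\<close>
    moreover have "R N \<nu> - V \<nu> = (\<integral>x. f x * f ((T ^^ N) x) - (f x)\<^sup>2 \<partial>\<nu>)"
      unfolding R_def V_def using int[OF \<nu>(1)] cont_fT cont_f2
      by (subst Bochner_Integration.integral_diff) auto
    then have "\<bar>R N \<nu> - V \<nu>\<bar> < \<epsilon>" using \<nu>(4) \<open>\<epsilon> > 0\<close> by linarith
    ultimately show ?thesis using \<nu>(1,2,5) V_eq[OF \<nu>(1)] by auto
  qed
  txt \<open>A strongly mixing measure lies in \<open>Z\<close> or in some \<open>E j m\<close>. A measure with \<open>V > 0\<close> is not in \<open>Z\<close>,
    and one with \<open>R N\<close> within \<open>c j / 2\<close> of \<open>V\<close> for some \<open>N \<ge> m\<close> is not in \<open>E j m\<close>.\<close>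
  define Z where "Z = {\<mu> \<in> invariant_measures T. V \<mu> \<in> {0}}"
  define c where "c j = 1 / real (Suc j)" for j
  define E where "E j m = {\<mu> \<in> invariant_measures T. V \<mu> \<in> {c j..}} \<inter>
    (\<Inter>k\<in>{m..}. {\<mu> \<in> invariant_measures T. R k \<mu> \<in> {- (c j / 2)..c j / 2}})" for j m
  \<comment> \<open>\<open>first_category_in\<close> asks for equality with a union, not for a
    cover, so the closed sets are intersected with the strongly mixing measures.\<close>
  have "nowhere_dense_in ?X (strongly_mixing_measures T \<inter> Z)"
  proof (rule nowhere_dense_inI[of _ Z])
    show "closedin ?X Z" unfolding Z_def by (rule closed[OF contV]) simp
    fix U \<mu> assume "openin ?X U" "\<mu> \<in> U"
    then obtain \<nu> where "\<nu> \<in> U" "0 < V \<nu>" using approx[of U \<mu> 1] by auto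
    then show "\<exists>\<nu>\<in>U. \<nu> \<notin> Z" by (intro bexI[of _ \<nu>]) (auto simp: Z_def)
  qed simp
  moreover have "nowhere_dense_in ?X (strongly_mixing_measures T \<inter> E j m)" for j m
  proof (rule nowhere_dense_inI[of _ "E j m"])
    show "closedin ?X (E j m)"
      unfolding E_def by (intro closedin_Int closedin_INT closed contV contR) auto
    fix U \<mu> assume "openin ?X U" "\<mu> \<in> U"
    moreover have "c j / 2 > 0" by (simp add: c_def)
    ultimately obtain \<nu> N where \<nu>: "\<nu> \<in> U" "m \<le> N" "\<bar>R N \<nu> - V \<nu>\<bar> < c j / 2"
      using approx[of U \<mu> "c j / 2" m] by blast
    have "\<nu> \<notin> E j m"
    proof
      assume "\<nu> \<in> E j m"
      then have "c j \<le> V \<nu>" "R N \<nu> \<le> c j / 2" using \<nu>(2) by (auto simp: E_def)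
      then show False using \<nu>(3) by linarith
    qed
    then show "\<exists>\<nu>\<in>U. \<nu> \<notin> E j m" using \<nu>(1) by blast
  qed simp
  moreover have "strongly_mixing_measures T
    = \<Union>(insert (strongly_mixing_measures T \<inter> Z) (range (\<lambda>(j, m). strongly_mixing_measures T \<inter> E j m)))"
    (is "_ = ?rhs")
  proof
    show "strongly_mixing_measures T \<subseteq> ?rhs"
    proof
      fix \<mu> assume \<mu>: "\<mu> \<in> strongly_mixing_measures T"
      then have inv: "\<mu> \<in> invariant_measures T" by (simp add: strongly_mixing_measures_def)
      show "\<mu> \<in> ?rhs"
      proof (cases "V \<mu> = 0")
        case True
        then show ?thesis using \<mu> inv by (simp add: Z_def)
      next
        case False
        then have "V \<mu> > 0" using V_nonneg[OF inv] by simp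
        then obtain j where j: "c j < V \<mu>" unfolding c_def using nat_approx_posE by blast
        \<comment> \<open>Strong mixing makes the autocovariances vanish in the limit, so from some
          \<open>m\<close> on they stay below half of the variance bound \<open>c j\<close>.\<close>
        have "(\<lambda>k. R k \<mu>) \<longlonglongrightarrow> 0"
          unfolding R_def using strongly_mixing_continuous[OF assms(1) \<mu> f(1)] by (simp add: LIM_zero)
        moreover have "0 < c j / 2" by (simp add: c_def)
        ultimately obtain m where "\<And>k. k \<ge> m \<Longrightarrow> \<bar>R k \<mu>\<bar> < c j / 2"
          unfolding LIMSEQ_iff by (metis diff_zero real_norm_def)
        then have "\<mu> \<in> E j m" using inv j by (force simp: E_def abs_less_iff)
        then show ?thesis using \<mu> by auto
      qed
    qed
  qed auto
  moreover have "first_category_in ?X ?rhs"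
  proof (rule first_category_in_countable_Union)
    show "countable (insert (strongly_mixing_measures T \<inter> Z) (range (\<lambda>(j, m). strongly_mixing_measures T \<inter> E j m)))"
      by (intro countable_insert countable_image) auto
  qed (use calculation(1,2) in auto)
  ultimately show ?thesis by simp
qed

end
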